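(* Let $(M,F)$ be a connected Kähler purely Hermitian complex Finsler space of complex dimension $2$. Then $\mathbf K$ is a constant on $(M,F)$ if and only if $J_{|\bar h}m^{\bar h}=0$.
   Context: $M$ is a complex manifold with $\dim_{\mathbb C}M=2$; $T'M$ is its holomorphic tangent bundle with local coordinates $(z^k,\eta^k)_{k=1,2}$; $\widetilde{T'M}$ is $T'M$ minus the zero section. A complex Finsler space $(M,F)$: $F:T'M\to[0,\infty)$ is continuous, $L:=F^2$ is smooth on $\widetilde{T'M}$, $F(z,\eta)=0$ iff $\eta=0$, $F(z,\lambda\eta)=|\lambda|F(z,\eta)$ for all $\lambda\in\mathbb C$, and the Hermitian matrix $g_{i\bar j}:=\partial^2L/\partial\eta^i\partial\bar\eta^j$ is positive definite on $\widetilde{T'M}$. "Connected" means $M$ is connected. Repeated indices are summed over $\{1,2\}$; everything lives on $\widetilde{T'M}$; bars on indices denote conjugation. $(g^{\bar m i})$ is the inverse matrix: $g^{\bar m i}g_{j\bar m}=\delta^i_j$. $(M,F)$ is purely Hermitian if $g_{i\bar j}=g_{i\bar j}(z)$ does not depend on $\eta$. Chern–Finsler connection: $\dot\partial_k:=\partial/\partial\eta^k$, $N^k_j:=g^{\bar mk}\frac{\partial g_{l\bar m}}{\partial z^j}\eta^l$, $\delta_k:=\frac{\partial}{\partial z^k}-N^j_k\dot\partial_j$, $\delta_{\bar k}:=\overline{\delta_k}$, $L^i_{jk}:=g^{\bar li}\delta_kg_{j\bar l}$. With $T^i_{jk}:=L^i_{jk}-L^i_{kj}$, the space is Kähler if $T^i_{jk}\eta^j=0$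 (known to be equivalent to $T^i_{jk}=0$). In a fixed local chart: $l^i:=\eta^i/F$, $l_i:=\frac1Fg_{i\bar j}\bar\eta^j$, $g:=\det(g_{i\bar j})$, $m^1:=-l_2/\sqrt g$, $m^2:=l_1/\sqrt g$, $m^{\bar h}:=\overline{m^h}$, $J:=l^jl^kl_iL^i_{jk}$. For a function $f$, $f_{|\bar h}:=\delta_{\bar h}f$, so $J_{|\bar h}m^{\bar h}=m^{\bar h}\delta_{\bar h}J$ (its vanishing is chart independent). The horizontal curvature invariant is $\mathbf K:=-\frac1F\bar\eta^k\delta_{\bar k}J$, a chart-independent function on $\widetilde{T'M}$; "constant on $(M,F)$" means constant on $\widetilde{T'M}$. *)

theory Defs
  imports "HOL-Analysis.Analysis"
begin

section \<open>Smooth and holomorphic maps\<close>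

text \<open>Only meant for open \<open>S\<close>; differentiability is over the reals.\<close>

primrec Ck_on :: "nat \<Rightarrow> ('a::real_normed_vector \<Rightarrow> 'b::real_normed_vector) \<Rightarrow> 'a set \<Rightarrow> bool" where
  "Ck_on 0 f S \<longleftrightarrow> continuous_on S f"
| "Ck_on (Suc k) f S \<longleftrightarrow>
     (\<forall>x\<in>S. f differentiable (at x)) \<and> (\<forall>v. Ck_on k (\<lambda>x. frechet_derivative f (at x) v) S)"

definition smooth_on :: "('a::real_normed_vector \<Rightarrow> 'b::real_normed_vector) \<Rightarrow> 'a set \<Rightarrow> bool" where
  "smooth_on f S \<longleftrightarrow> (\<forall>k. Ck_on k f S)"

text \<open>Holomorphic maps of several variables on an open set: the derivative exists everywhere and
  is complex linear.\<close>

definition holomorphic_map_on ::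
  "(complex^'n \<Rightarrow> complex^'m) \<Rightarrow> (complex^'n) set \<Rightarrow> bool" where
  "holomorphic_map_on f S \<longleftrightarrow> (\<forall>z\<in>S. \<exists>B :: complex^'n^'m. (f has_derivative (\<lambda>v. B *v v)) (at z))"


section \<open>Complex manifolds and the holomorphic tangent bundle\<close>

text \<open>A chart is its domain together with its coordinate map; the values of the
  coordinate map outside the domain are irrelevant.\<close>

type_synonym ('a, 'n) chart = "'a set \<times> ('a \<Rightarrow> (complex, 'n) vec)"

definition is_chart :: "'a topology \<Rightarrow> ('a, 'n::finite) chart \<Rightarrow> bool" where
  "is_chart X c \<longleftrightarrow> openin X (fst c) \<and> open (snd c ` fst c) \<and>
     homeomorphic_map (subtopology X (fst c)) (top_of_set (snd c ` fst c)) (snd c)"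

definition transition :: "('a, 'n::finite) chart \<Rightarrow> ('a, 'n) chart \<Rightarrow> complex^'n \<Rightarrow> complex^'n" where
  "transition c d = snd d \<circ> inv_into (fst c) (snd c)"

locale complex_manifold =
  fixes M :: "'a topology" and A :: "('a, 'n::finite) chart set"
  assumes hausdorff: "Hausdorff_space M"
    and second_countable: "\<exists>B. countable B \<and> openin M = arbitrary union_of (\<lambda>U. U \<in> B)"
    and charts: "c \<in> A \<Longrightarrow> is_chart M c"
    and cover: "topspace M = (\<Union>c\<in>A. fst c)"
    and compatible: "c \<in> A \<Longrightarrow> d \<in> A \<Longrightarrow>
      holomorphic_map_on (transition c d) (snd c ` (fst c \<inter> fst d))"

text \<open>A holomorphic tangent vector at \<open>p\<close> is given by its component vectors in all charts around
  \<open>p\<close>, which transform by the Jacobians of the transition maps. By convention the components are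
  \<open>0\<close> for charts not containing \<open>p\<close>.\<close>

type_synonym ('a, 'n) tangent = "'a \<times> (('a, 'n) chart \<Rightarrow> (complex, 'n) vec)"

definition tangent_bundle :: "('a, 'n::finite) chart set \<Rightarrow> ('a, 'n) tangent set" where
  "tangent_bundle A = {(p, v).
     p \<in> (\<Union>c\<in>A. fst c) \<and>
     (\<forall>c. \<not> (c \<in> A \<and> p \<in> fst c) \<longrightarrow> v c = 0) \<and>
     (\<forall>c\<in>A. \<forall>d\<in>A. p \<in> fst c \<inter> fst d \<longrightarrow>
        v d = frechet_derivative (transition c d) (at (snd c p)) (v c))}"

definition tangent_scale :: "complex \<Rightarrow> ('a, 'n::finite) tangent \<Rightarrow> ('a, 'n) tangent" where
  "tangent_scale a \<xi> = (fst \<xi>, \<lambda>c. a *s snd \<xi> c)"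

text \<open>The tangent vector with induced bundle coordinates \<open>(z, \<eta>)\<close> in the chart \<open>c\<close>.\<close>

definition of_coords :: "('a, 'n::finite) chart set \<Rightarrow> ('a, 'n) chart \<Rightarrow>
    (complex^'n) \<times> (complex^'n) \<Rightarrow> ('a, 'n) tangent" where
  "of_coords A c x = (let p = inv_into (fst c) (snd c) (fst x) in
     (p, \<lambda>d. if d \<in> A \<and> p \<in> fst d
             then frechet_derivative (transition c d) (at (fst x)) (snd x) else 0))"

definition local_rep :: "('a, 'n::finite) chart set \<Rightarrow> (('a, 'n) tangent \<Rightarrow> real) \<Rightarrow>
    ('a, 'n) chart \<Rightarrow> (complex^'n) \<times> (complex^'n) \<Rightarrow> real" where
  "local_rep A F c = (\<lambda>x. F (of_coords A c x))"

text \<open>Coordinate images of the tangent bundle and of the slit tangent bundle over the chart \<open>c\<close>.\<close>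

definition coord_dom :: "('a, 'n::finite) chart \<Rightarrow> ((complex^'n) \<times> (complex^'n)) set" where
  "coord_dom c = (snd c ` fst c) \<times> UNIV"

definition slit_dom :: "('a, 'n::finite) chart \<Rightarrow> ((complex^'n) \<times> (complex^'n)) set" where
  "slit_dom c = (snd c ` fst c) \<times> (UNIV - {0})"


section \<open>Local Finsler geometry\<close>

text \<open>Wirtinger derivatives with respect to \<open>z\<^sup>k\<close>, its conjugate, \<open>\<eta>\<^sup>k\<close> and its conjugate, at
  \<open>x = (z, \<eta>)\<close>.\<close>

definition d_z :: "'n \<Rightarrow> ((complex^'n) \<times> (complex^'n) \<Rightarrow> complex) \<Rightarrow>
    (complex^'n::finite) \<times> (complex^'n) \<Rightarrow> complex" where
  "d_z k f x = (frechet_derivative f (at x) (axis k 1, 0)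
                - \<i> * frechet_derivative f (at x) (axis k \<i>, 0)) / 2"

definition d_zbar :: "'n \<Rightarrow> ((complex^'n) \<times> (complex^'n) \<Rightarrow> complex) \<Rightarrow>
    (complex^'n::finite) \<times> (complex^'n) \<Rightarrow> complex" where
  "d_zbar k f x = (frechet_derivative f (at x) (axis k 1, 0)
                + \<i> * frechet_derivative f (at x) (axis k \<i>, 0)) / 2"

definition d_eta :: "'n \<Rightarrow> ((complex^'n) \<times> (complex^'n) \<Rightarrow> complex) \<Rightarrow>
    (complex^'n::finite) \<times> (complex^'n) \<Rightarrow> complex" where
  "d_eta k f x = (frechet_derivative f (at x) (0, axis k 1)
                - \<i> * frechet_derivative f (at x) (0, axis k \<i>)) / 2"

definition d_etabar :: "'n \<Rightarrow> ((complex^'n) \<times> (complex^'n) \<Rightarrow> complex) \<Rightarrow>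
    (complex^'n::finite) \<times> (complex^'n) \<Rightarrow> complex" where
  "d_etabar k f x = (frechet_derivative f (at x) (0, axis k 1)
                + \<i> * frechet_derivative f (at x) (0, axis k \<i>)) / 2"

text \<open>In the following, \<open>F\<close> is the representation of the Finsler metric in one chart. The
  fundamental tensor \<open>gmat F x $ i $ j\<close> has \<open>i\<close> as holomorphic and \<open>j\<close> as conjugate index;
  accordingly \<open>ginv F x $ m $ i\<close> has \<open>m\<close> as conjugate index.\<close>

definition gmat :: "((complex^'n) \<times> (complex^'n) \<Rightarrow> real) \<Rightarrow>
    (complex^'n::finite) \<times> (complex^'n) \<Rightarrow> complex^'n^'n" where
  "gmat F x = (\<chi> i j. d_eta i (d_etabar j (\<lambda>y. complex_of_real ((F y)\<^sup>2))) x)"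

definition ginv :: "((complex^'n) \<times> (complex^'n) \<Rightarrow> real) \<Rightarrow>
    (complex^'n::finite) \<times> (complex^'n) \<Rightarrow> complex^'n^'n" where
  "ginv F x = matrix_inv (gmat F x)"

definition hermitian_pos_def :: "complex^'n^'n \<Rightarrow> bool" where
  "hermitian_pos_def G \<longleftrightarrow> (\<forall>i j. G $ j $ i = cnj (G $ i $ j)) \<and>
     (\<forall>v. v \<noteq> 0 \<longrightarrow> 0 < Re (\<Sum>i\<in>UNIV. \<Sum>j\<in>UNIV. G $ i $ j * v $ i * cnj (v $ j)))"

text \<open>\<open>nonlin_conn F k j\<close> is \<open>N\<^sup>k\<^sub>j\<close>, \<open>hconn F i j k\<close> is \<open>L\<^sup>i\<^sub>j\<^sub>k\<close> and \<open>torsion F i j k\<close> is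
  \<open>T\<^sup>i\<^sub>j\<^sub>k\<close>; \<open>delta\<close> and \<open>deltabar\<close> are the horizontal derivations and their conjugates.\<close>

definition nonlin_conn :: "((complex^'n) \<times> (complex^'n) \<Rightarrow> real) \<Rightarrow> 'n \<Rightarrow> 'n \<Rightarrow>
    (complex^'n::finite) \<times> (complex^'n) \<Rightarrow> complex" where
  "nonlin_conn F k j x =
     (\<Sum>m\<in>UNIV. \<Sum>l\<in>UNIV. ginv F x $ m $ k * d_z j (\<lambda>y. gmat F y $ l $ m) x * snd x $ l)"

definition delta :: "((complex^'n) \<times> (complex^'n) \<Rightarrow> real) \<Rightarrow> 'n \<Rightarrow>
    ((complex^'n) \<times> (complex^'n) \<Rightarrow> complex) \<Rightarrow> (complex^'n::finite) \<times> (complex^'n) \<Rightarrow> complex" where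
  "delta F k f x = d_z k f x - (\<Sum>j\<in>UNIV. nonlin_conn F j k x * d_eta j f x)"

definition deltabar :: "((complex^'n) \<times> (complex^'n) \<Rightarrow> real) \<Rightarrow> 'n \<Rightarrow>
    ((complex^'n) \<times> (complex^'n) \<Rightarrow> complex) \<Rightarrow> (complex^'n::finite) \<times> (complex^'n) \<Rightarrow> complex" where
  "deltabar F k f x = d_zbar k f x - (\<Sum>j\<in>UNIV. cnj (nonlin_conn F j k x) * d_etabar j f x)"

definition hconn :: "((complex^'n) \<times> (complex^'n) \<Rightarrow> real) \<Rightarrow> 'n \<Rightarrow> 'n \<Rightarrow> 'n \<Rightarrow>
    (complex^'n::finite) \<times> (complex^'n) \<Rightarrow> complex" where
  "hconn F i j k x = (\<Sum>l\<in>UNIV. ginv F x $ l $ i * delta F k (\<lambda>y. gmat F y $ j $ l) x)"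

definition torsion :: "((complex^'n) \<times> (complex^'n) \<Rightarrow> real) \<Rightarrow> 'n \<Rightarrow> 'n \<Rightarrow> 'n \<Rightarrow>
    (complex^'n::finite) \<times> (complex^'n) \<Rightarrow> complex" where
  "torsion F i j k x = hconn F i j k x - hconn F i k j x"

definition l_up :: "((complex^'n) \<times> (complex^'n) \<Rightarrow> real) \<Rightarrow> 'n \<Rightarrow>
    (complex^'n::finite) \<times> (complex^'n) \<Rightarrow> complex" where
  "l_up F i x = snd x $ i / complex_of_real (F x)"

definition l_low :: "((complex^'n) \<times> (complex^'n) \<Rightarrow> real) \<Rightarrow> 'n \<Rightarrow>
    (complex^'n::finite) \<times> (complex^'n) \<Rightarrow> complex" where
  "l_low F i x = (\<Sum>j\<in>UNIV. gmat F x $ i $ j * cnj (snd x $ j)) / complex_of_real (F x)"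

definition J_inv :: "((complex^'n) \<times> (complex^'n) \<Rightarrow> real) \<Rightarrow>
    (complex^'n::finite) \<times> (complex^'n) \<Rightarrow> complex" where
  "J_inv F x = (\<Sum>i\<in>UNIV. \<Sum>j\<in>UNIV. \<Sum>k\<in>UNIV.
     l_up F j x * l_up F k x * l_low F i x * hconn F i j k x)"

definition K_inv :: "((complex^'n) \<times> (complex^'n) \<Rightarrow> real) \<Rightarrow>
    (complex^'n::finite) \<times> (complex^'n) \<Rightarrow> complex" where
  "K_inv F x = - (1 / complex_of_real (F x)) *
     (\<Sum>k\<in>UNIV. cnj (snd x $ k) * deltabar F k (J_inv F) x)"

text \<open>In dimension 2: the vector \<open>m\<close>. The determinant of the fundamental tensor is a positive
  real, so \<open>csqrt\<close> is its positive square root. (In the index type \<open>2\<close>, the two elements are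
  \<open>1\<close> and \<open>2\<close>.)\<close>

definition m_up :: "((complex^2) \<times> (complex^2) \<Rightarrow> real) \<Rightarrow> 2 \<Rightarrow>
    (complex^2) \<times> (complex^2) \<Rightarrow> complex" where
  "m_up F h x = (if h = 1 then - l_low F 2 x / csqrt (det (gmat F x))
                 else l_low F 1 x / csqrt (det (gmat F x)))"

definition J_hbar_mbar :: "((complex^2) \<times> (complex^2) \<Rightarrow> real) \<Rightarrow>
    (complex^2) \<times> (complex^2) \<Rightarrow> complex" where
  "J_hbar_mbar F x = (\<Sum>h\<in>UNIV. deltabar F h (J_inv F) x * cnj (m_up F h x))"


section \<open>Complex Finsler spaces\<close>

text \<open>Continuity on the tangent bundle and smoothness on the slit tangent bundle refer to the
  topology and smooth structure for which the induced bundle coordinates are charts.\<close>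

locale complex_finsler_space = complex_manifold M A
  for M :: "'a topology" and A :: "('a, 'n::finite) chart set" +
  fixes F :: "('a, 'n) tangent \<Rightarrow> real"
  assumes nonneg: "\<xi> \<in> tangent_bundle A \<Longrightarrow> 0 \<le> F \<xi>"
    and continuous: "c \<in> A \<Longrightarrow> continuous_on (coord_dom c) (local_rep A F c)"
    and smooth: "c \<in> A \<Longrightarrow> smooth_on (\<lambda>x. (local_rep A F c x)\<^sup>2) (slit_dom c)"
    and eq_zero_iff: "\<xi> \<in> tangent_bundle A \<Longrightarrow> F \<xi> = 0 \<longleftrightarrow> snd \<xi> = (\<lambda>_. 0)"
    and homogeneous: "\<xi> \<in> tangent_bundle A \<Longrightarrow> F (tangent_scale a \<xi>) = cmod a * F \<xi>"
    and pos_def: "c \<in> A \<Longrightarrow> x \<in> slit_dom c \<Longrightarrow> hermitian_pos_def (gmat (local_rep A F c) x)"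

definition kaehler :: "('a, 'n::finite) chart set \<Rightarrow> (('a, 'n) tangent \<Rightarrow> real) \<Rightarrow> bool" where
  "kaehler A F \<longleftrightarrow> (\<forall>c\<in>A. \<forall>x\<in>slit_dom c. \<forall>i k.
     (\<Sum>j\<in>UNIV. torsion (local_rep A F c) i j k x * snd x $ j) = 0)"

definition purely_hermitian :: "('a, 'n::finite) chart set \<Rightarrow> (('a, 'n) tangent \<Rightarrow> real) \<Rightarrow> bool" where
  "purely_hermitian A F \<longleftrightarrow> (\<forall>c\<in>A. \<forall>z \<eta> \<eta>'. (z, \<eta>) \<in> slit_dom c \<longrightarrow> (z, \<eta>') \<in> slit_dom c \<longrightarrow>
     gmat (local_rep A F c) (z, \<eta>) = gmat (local_rep A F c) (z, \<eta>'))"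

end

theory Submission
  imports Defs "HOL-Complex_Analysis.Cauchy_Integral_Formula"
begin

text \<open>On a chart the fundamental tensor is a Kaehler metric \<open>g(z)\<close>, so \<open>L = g(\<eta>, \<eta>)\<close> by Euler's
  relation, and \<open>deltabar L = 0\<close> gives \<open>J\<^sub>|\<^sub>h = - F\<^sup>-\<^sup>3 R(\<eta>, \<eta>, \<eta>, \<partial>\<^sub>h)\<close> and
  \<open>K F\<^sup>4 = R(\<eta>, \<eta>, \<eta>, \<eta>)\<close> with \<open>R\<close> the curvature tensor. Both conditions of the theorem are
  polynomial identities in \<open>\<eta>\<close> and its conjugate; polarising them shows that each forces
  \<open>R j m k h = c (g j m g k h + g j h g k m)\<close>. If \<open>K\<close> is constant this gives the vanishing of the
  mixed component at once. Conversely the second Bianchi identity makes \<open>c\<close> locally constant on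
  every chart (Schur). To compare charts, let \<open>\<sigma>\<close> be a holomorphic curve: the mixed second
  derivative of \<open>g(\<sigma>', \<sigma>')\<close> is the squared norm of the covariant acceleration minus
  \<open>R(\<sigma>', \<sigma>', \<sigma>', \<sigma>')\<close>, so the holomorphic sectional curvature is minus the smallest such second
  derivative and hence invariant. Connectedness of \<open>M\<close> does the rest.\<close>

section \<open>Calculus of smooth maps\<close>

text \<open>The obstacle is the comparison of charts. The transformation law of the curvature tensor
  involves second derivatives of the transition maps, whereas holomorphy of these maps is given only
  as a complex linear first derivative at each point. Along a curve with a complex parameter,
  Cauchy's theory in one variable supplies all further derivatives, hence the detour through curves.
  One inequality between curvatures suffices, since the two charts can be exchanged. As it compares
  real parts, reality of \<open>c\<close> is shown separately; the same reality lets Schur's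
  argument pass from the holomorphic derivatives of \<open>c\<close> to its full derivative. Both
  terms of the model tensor contract to \<open>F^4\<close>, so \<open>K = 2 c\<close>.\<close>

lemma Ck_on_cong:
  assumes "open S" "\<And>x. x \<in> S \<Longrightarrow> f x = g x" "Ck_on k f S"
  shows "Ck_on k g S"
  using assms(2,3)
proof (induction k arbitrary: f g)
  case 0
  then show ?case by (simp add: continuous_on_eq)
next
  case (Suc k)
  have *: "(g has_derivative frechet_derivative f (at x)) (at x)" if "x \<in> S" for x
    using Suc.prems that assms(1) has_derivative_transform_within_open frechet_derivative_works
    by (metis Ck_on.simps(2))
  have "frechet_derivative f (at x) v = frechet_derivative g (at x) v" if "x \<in> S" for x v
    by (rule fun_cong[OF frechet_derivative_at[OF *[OF that]]])
  then have "\<And>v. Ck_on k (\<lambda>x. frechet_derivative g (at x) v) S"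
    using Suc.IH[OF _ spec[OF conjunct2[OF Suc.prems(2)[unfolded Ck_on.simps]]]] by simp
  with * show ?case by (auto simp: differentiable_def)
qed

text \<open>An explicit derivative formula may stand in for \<open>frechet_derivative\<close>, with
  which it agrees on the open set. The closure properties below are inductions that supply such a
  formula.\<close>

lemma Ck_on_SucI:
  assumes "open S" "\<And>x. x \<in> S \<Longrightarrow> (f has_derivative f' x) (at x)" "\<And>v. Ck_on k (\<lambda>x. f' x v) S"
  shows "Ck_on (Suc k) f S"
proof -
  have "Ck_on k (\<lambda>x. frechet_derivative f (at x) v) S" for v
    by (rule Ck_on_cong[OF assms(1) _ assms(3)[of v]])
      (rule fun_cong[OF frechet_derivative_at[OF assms(2)]])
  with assms(2) show ?thesis by (auto simp: differentiable_def)
qed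

lemma Ck_on_has_derivative:
  "Ck_on (Suc k) f S \<Longrightarrow> x \<in> S \<Longrightarrow> (f has_derivative frechet_derivative f (at x)) (at x)"
  by (simp add: frechet_derivative_works[symmetric])

text \<open>The recursion puts order \<open>k\<close> on the derivatives, not on \<open>f\<close>.
  Product and reciprocal rules need it for \<open>f\<close> as well, because the functions reappear
  next to their derivatives.\<close>

lemma Ck_on_SucD: "Ck_on (Suc k) f S \<Longrightarrow> Ck_on k f S"
proof (induction k arbitrary: f)
  case 0
  then show ?case
    by (simp add: continuous_at_imp_continuous_on differentiable_imp_continuous_within)
qed simp

lemma Ck_on_const: "open S \<Longrightarrow> Ck_on k (\<lambda>x. c) S"
proof (induction k arbitrary: c)
  case (Suc k)
  then show ?case by (intro Ck_on_SucI[where f' = "\<lambda>x v. 0"]) auto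
qed simp

lemma Ck_on_bounded_linear_id:
  assumes "open S" "bounded_linear f"
  shows "Ck_on k f S"
proof (cases k)
  case 0
  then show ?thesis by (simp add: assms linear_continuous_on)
next
  case (Suc m)
  show ?thesis unfolding Suc
    by (rule Ck_on_SucI[where f' = "\<lambda>x. f"])
      (auto simp: assms Ck_on_const bounded_linear_imp_has_derivative)
qed

lemma Ck_on_bounded_linear:
  assumes "open S" "bounded_linear g" "Ck_on k f S"
  shows "Ck_on k (\<lambda>x. g (f x)) S"
  using assms(3)
proof (induction k arbitrary: f)
  case 0
  then show ?case
    using bounded_linear.continuous_on[OF assms(2)] by auto
next
  case (Suc k)
  show ?case
    by (rule Ck_on_SucI[where f' = "\<lambda>x v. g (frechet_derivative f (at x) v)", OF assms(1)])
      (use Suc in \<open>auto intro: bounded_linear.has_derivative[OF assms(2)]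
        simp: frechet_derivative_works[symmetric]\<close>)
qed

lemma Ck_on_add:
  assumes "open S" "Ck_on k f S" "Ck_on k g S"
  shows "Ck_on k (\<lambda>x. f x + g x) S"
  using assms(2,3)
proof (induction k arbitrary: f g)
  case 0
  then show ?case by (simp add: continuous_on_add)
next
  case (Suc k)
  show ?case
    by (rule Ck_on_SucI[where f' = "\<lambda>x v. frechet_derivative f (at x) v + frechet_derivative g (at x) v",
          OF assms(1)])
      (use Suc in \<open>auto intro!: has_derivative_add simp: frechet_derivative_works[symmetric]\<close>)
qed

lemma Ck_on_mult:
  fixes f g :: "'a::real_normed_vector \<Rightarrow> 'b::real_normed_algebra"
  assumes "open S" "Ck_on k f S" "Ck_on k g S"
  shows "Ck_on k (\<lambda>x. f x * g x) S"
  using assms(2,3)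
proof (induction k arbitrary: f g)
  case 0
  then show ?case by (simp add: continuous_on_mult)
next
  case (Suc k)
  show ?case
  proof (rule Ck_on_SucI[where f' = "\<lambda>x v. f x * frechet_derivative g (at x) v + frechet_derivative f (at x) v * g x",
          OF assms(1)])
    fix x assume "x \<in> S"
    then show "((\<lambda>x. f x * g x) has_derivative
        (\<lambda>v. f x * frechet_derivative g (at x) v + frechet_derivative f (at x) v * g x)) (at x)"
      using Suc.prems by (intro has_derivative_mult) (auto intro: Ck_on_has_derivative)
  next
    fix v
    show "Ck_on k (\<lambda>x. f x * frechet_derivative g (at x) v + frechet_derivative f (at x) v * g x) S"
      using Suc.prems Ck_on_SucD[OF Suc.prems(1)] Ck_on_SucD[OF Suc.prems(2)]
      by (intro Ck_on_add[OF assms(1)] Suc.IH) auto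
  qed
qed

lemma Ck_on_inverse:
  fixes f :: "'a::real_normed_vector \<Rightarrow> 'b::real_normed_field"
  assumes "open S" "Ck_on k f S" "\<And>x. x \<in> S \<Longrightarrow> f x \<noteq> 0"
  shows "Ck_on k (\<lambda>x. inverse (f x)) S"
  using assms(2,3)
proof (induction k arbitrary: f)
  case 0
  then show ?case by (simp add: continuous_on_inverse)
next
  case (Suc k)
  show ?case
  proof (rule Ck_on_SucI[where f' = "\<lambda>x v. - (inverse (f x) * frechet_derivative f (at x) v * inverse (f x))",
          OF assms(1)])
    fix x assume "x \<in> S"
    then show "((\<lambda>x. inverse (f x)) has_derivative
        (\<lambda>v. - (inverse (f x) * frechet_derivative f (at x) v * inverse (f x)))) (at x)"
      using Suc.prems by (intro Deriv.has_derivative_inverse) (auto intro: Ck_on_has_derivative)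
  next
    fix v
    show "Ck_on k (\<lambda>x. - (inverse (f x) * frechet_derivative f (at x) v * inverse (f x))) S"
      using Suc.prems Ck_on_SucD[OF Suc.prems(1)]
      by (intro Ck_on_bounded_linear[OF assms(1) bounded_linear_minus[OF bounded_linear_ident]]
          Ck_on_mult[OF assms(1)] Suc.IH) auto
  qed
qed

text \<open>Freezing the fibre coordinate carries smoothness from the slit bundle down to the base;
  the fundamental tensor obtains its smoothness this way.\<close>

lemma Ck_on_slice:
  fixes e :: "'b::real_normed_vector"
  assumes "open U" "Ck_on k f S" "\<And>z. z \<in> U \<Longrightarrow> (z, e) \<in> S"
  shows "Ck_on k (\<lambda>z. f (z, e)) U"
  using assms(2)
proof (induction k arbitrary: f)
  case 0
  then have "continuous_on S f" by simp
  moreover have "continuous_on U (\<lambda>z. (z, e))" by (intro continuous_intros)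
  ultimately show ?case
    using continuous_on_compose2[of S f U "\<lambda>z. (z, e)"] assms(3) by auto
next
  case (Suc k)
  show ?case
  proof (rule Ck_on_SucI[where f' = "\<lambda>z v. frechet_derivative f (at (z, e)) (v, 0)", OF assms(1)])
    fix z assume "z \<in> U"
    then have "(f has_derivative frechet_derivative f (at (z, e))) (at (z, e))"
      using Suc.prems assms(3) Ck_on_has_derivative by blast
    moreover have "((\<lambda>z. (z, e)) has_derivative (\<lambda>v. (v, 0))) (at z)"
      by (intro has_derivative_Pair has_derivative_ident has_derivative_const)
    ultimately show "((\<lambda>z. f (z, e)) has_derivative (\<lambda>v. frechet_derivative f (at (z, e)) (v, 0))) (at z)"
      by (rule has_derivative_compose[rotated])
  next
    fix v
    show "Ck_on k (\<lambda>z. frechet_derivative f (at (z, e)) (v, 0)) U"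
      by (rule Suc.IH) (use Suc.prems in simp)
  qed
qed

section \<open>Closure properties of smooth maps\<close>

lemma smooth_on_cong:
  "open S \<Longrightarrow> (\<And>x. x \<in> S \<Longrightarrow> f x = g x) \<Longrightarrow> smooth_on f S \<Longrightarrow> smooth_on g S"
  unfolding smooth_on_def using Ck_on_cong by blast

lemma smooth_on_differentiable: "smooth_on f S \<Longrightarrow> x \<in> S \<Longrightarrow> f differentiable (at x)"
  unfolding smooth_on_def using Ck_on.simps(2) by blast

lemma smooth_on_has_derivative:
  "smooth_on f S \<Longrightarrow> x \<in> S \<Longrightarrow> (f has_derivative frechet_derivative f (at x)) (at x)"
  using frechet_derivative_works smooth_on_differentiable by blast

lemma smooth_on_frechet_derivative:
  "smooth_on f S \<Longrightarrow> smooth_on (\<lambda>x. frechet_derivative f (at x) v) S"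
  unfolding smooth_on_def using Ck_on.simps(2) by blast

lemma smooth_on_continuous: "smooth_on f S \<Longrightarrow> continuous_on S f"
  unfolding smooth_on_def using Ck_on.simps(1) by blast

lemma smooth_on_const [simp]: "open S \<Longrightarrow> smooth_on (\<lambda>x. c) S"
  by (simp add: smooth_on_def Ck_on_const)

lemma smooth_on_bounded_linear:
  "open S \<Longrightarrow> bounded_linear g \<Longrightarrow> smooth_on f S \<Longrightarrow> smooth_on (\<lambda>x. g (f x)) S"
  by (simp add: smooth_on_def Ck_on_bounded_linear)

lemma smooth_on_add [simp]:
  "open S \<Longrightarrow> smooth_on f S \<Longrightarrow> smooth_on g S \<Longrightarrow> smooth_on (\<lambda>x. f x + g x) S"
  by (simp add: smooth_on_def Ck_on_add)

lemma smooth_on_mult [simp]: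
  fixes f g :: "'a::real_normed_vector \<Rightarrow> 'b::real_normed_algebra"
  shows "open S \<Longrightarrow> smooth_on f S \<Longrightarrow> smooth_on g S \<Longrightarrow> smooth_on (\<lambda>x. f x * g x) S"
  by (simp add: smooth_on_def Ck_on_mult)

lemma smooth_on_inverse:
  fixes f :: "'a::real_normed_vector \<Rightarrow> 'b::real_normed_field"
  shows "open S \<Longrightarrow> smooth_on f S \<Longrightarrow> (\<And>x. x \<in> S \<Longrightarrow> f x \<noteq> 0) \<Longrightarrow> smooth_on (\<lambda>x. inverse (f x)) S"
  by (simp add: smooth_on_def Ck_on_inverse)

lemma smooth_on_minus [simp]: "open S \<Longrightarrow> smooth_on f S \<Longrightarrow> smooth_on (\<lambda>x. - f x) S"
  by (rule smooth_on_bounded_linear[OF _ bounded_linear_minus[OF bounded_linear_ident]])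

lemma smooth_on_diff [simp]:
  "open S \<Longrightarrow> smooth_on f S \<Longrightarrow> smooth_on g S \<Longrightarrow> smooth_on (\<lambda>x. f x - g x) S"
  using smooth_on_add[of S f "\<lambda>x. - g x"] by simp

lemma smooth_on_cnj [simp]: "open S \<Longrightarrow> smooth_on f S \<Longrightarrow> smooth_on (\<lambda>x. cnj (f x)) S"
  by (rule smooth_on_bounded_linear[OF _ bounded_linear_cnj])

lemma smooth_on_sum [simp]:
  "open S \<Longrightarrow> (\<And>i. i \<in> I \<Longrightarrow> smooth_on (f i) S) \<Longrightarrow> smooth_on (\<lambda>x. \<Sum>i\<in>I. f i x) S"
  by (induction I rule: infinite_finite_induct) auto

lemma smooth_on_slice:
  "open U \<Longrightarrow> smooth_on f S \<Longrightarrow> (\<And>z. z \<in> U \<Longrightarrow> (z, e) \<in> S) \<Longrightarrow> smooth_on (\<lambda>z. f (z, e)) U"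
  unfolding smooth_on_def using Ck_on_slice by blast

text \<open>Both iterated derivatives are limits of the same second difference quotient.\<close>

lemma second_difference_mean_value:
  fixes f :: "'a::real_normed_vector \<Rightarrow> real"
  assumes sm: "smooth_on f S" and h: "0 < h"
    and S: "\<And>s t. 0 \<le> s \<Longrightarrow> s \<le> h \<Longrightarrow> 0 \<le> t \<Longrightarrow> t \<le> h \<Longrightarrow> x + s *\<^sub>R u + t *\<^sub>R v \<in> S"
  obtains s t where "0 < s" "s < h" "0 < t" "t < h"
    "f (x + h *\<^sub>R u + h *\<^sub>R v) - f (x + h *\<^sub>R u) - f (x + h *\<^sub>R v) + f x =
     h * h * frechet_derivative (\<lambda>y. frechet_derivative f (at y) u) (at (x + s *\<^sub>R u + t *\<^sub>R v)) v"
proof -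
  have D1: "DERIV (\<lambda>s. g (x + s *\<^sub>R u + t *\<^sub>R v)) s :> frechet_derivative g (at (x + s *\<^sub>R u + t *\<^sub>R v)) u"
    if "smooth_on g S" "0 \<le> s" "s \<le> h" "0 \<le> t" "t \<le> h" for g :: "'a \<Rightarrow> real" and s t
  proof -
    have "((\<lambda>s. x + s *\<^sub>R u + t *\<^sub>R v) has_derivative (\<lambda>r. r *\<^sub>R u)) (at s)"
      by (auto intro!: derivative_eq_intros)
    from has_derivative_compose[OF this smooth_on_has_derivative[OF that(1) S[OF that(2-5)]]]
    have "((\<lambda>s. g (x + s *\<^sub>R u + t *\<^sub>R v)) has_derivative
       (\<lambda>r. frechet_derivative g (at (x + s *\<^sub>R u + t *\<^sub>R v)) (r *\<^sub>R u))) (at s)" .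
    moreover have "linear (frechet_derivative g (at (x + s *\<^sub>R u + t *\<^sub>R v)))"
      by (meson S linear_frechet_derivative smooth_on_differentiable that)
    ultimately show ?thesis
      by (simp add: has_field_derivative_def linear_cmul mult_commute_abs)
  qed
  have D2: "DERIV (\<lambda>t. g (x + s *\<^sub>R u + t *\<^sub>R v)) t :> frechet_derivative g (at (x + s *\<^sub>R u + t *\<^sub>R v)) v"
    if "smooth_on g S" "0 \<le> s" "s \<le> h" "0 \<le> t" "t \<le> h" for g :: "'a \<Rightarrow> real" and s t
  proof -
    have "((\<lambda>t. x + s *\<^sub>R u + t *\<^sub>R v) has_derivative (\<lambda>r. r *\<^sub>R v)) (at t)"
      by (auto intro!: derivative_eq_intros)
    from has_derivative_compose[OF this smooth_on_has_derivative[OF that(1) S[OF that(2-5)]]]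
    have "((\<lambda>t. g (x + s *\<^sub>R u + t *\<^sub>R v)) has_derivative
       (\<lambda>r. frechet_derivative g (at (x + s *\<^sub>R u + t *\<^sub>R v)) (r *\<^sub>R v))) (at t)" .
    moreover have "linear (frechet_derivative g (at (x + s *\<^sub>R u + t *\<^sub>R v)))"
      by (meson S linear_frechet_derivative smooth_on_differentiable that)
    ultimately show ?thesis
      by (simp add: has_field_derivative_def linear_cmul mult_commute_abs)
  qed
  \<comment> \<open>The mean value theorem is used twice: in \<open>s\<close> for the increment
    \<open>?g\<close> taken in direction \<open>v\<close>, then in \<open>t\<close> for the
    \<open>u\<close>-derivative. The summand \<open>0 *\<^sub>R v\<close> keeps the shape that
    \<open>D1\<close> and \<open>D2\<close> expect.\<close>
  let ?g = "\<lambda>s. f (x + s *\<^sub>R u + h *\<^sub>R v) - f (x + s *\<^sub>R u + 0 *\<^sub>R v)"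
  let ?Du = "\<lambda>y. frechet_derivative f (at y) u"
  have "\<exists>s>0. s < h \<and> ?g h - ?g 0 = (h - 0) * (?Du (x + s *\<^sub>R u + h *\<^sub>R v) - ?Du (x + s *\<^sub>R u + 0 *\<^sub>R v))"
    by (intro MVT2[OF h] DERIV_diff D1 sm) (use h in auto)
  then obtain s where s: "0 < s" "s < h"
    "?g h - ?g 0 = h * (?Du (x + s *\<^sub>R u + h *\<^sub>R v) - ?Du (x + s *\<^sub>R u + 0 *\<^sub>R v))" by auto
  have "\<exists>t>0. t < h \<and> ?Du (x + s *\<^sub>R u + h *\<^sub>R v) - ?Du (x + s *\<^sub>R u + 0 *\<^sub>R v) =
     (h - 0) * frechet_derivative ?Du (at (x + s *\<^sub>R u + t *\<^sub>R v)) v"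
    by (intro MVT2[OF h] D2 smooth_on_frechet_derivative sm) (use h s in auto)
  then obtain t where "0 < t" "t < h" "?Du (x + s *\<^sub>R u + h *\<^sub>R v) - ?Du (x + s *\<^sub>R u + 0 *\<^sub>R v) =
     h * frechet_derivative ?Du (at (x + s *\<^sub>R u + t *\<^sub>R v)) v" by auto
  with s that[of s t] show ?thesis by (simp add: algebra_simps)
qed

lemma frechet_derivative_commute_real:
  fixes f :: "'a::real_normed_vector \<Rightarrow> real"
  assumes "open S" and sm: "smooth_on f S" and x: "x \<in> S"
  shows "frechet_derivative (\<lambda>y. frechet_derivative f (at y) u) (at x) v =
         frechet_derivative (\<lambda>y. frechet_derivative f (at y) v) (at x) u"
proof (rule ccontr)
  let ?A = "\<lambda>x. frechet_derivative (\<lambda>y. frechet_derivative f (at y) u) (at x) v"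
  let ?B = "\<lambda>x. frechet_derivative (\<lambda>y. frechet_derivative f (at y) v) (at x) u"
  assume ne: "?A x \<noteq> ?B x"
  \<comment> \<open>Half the gap: the two iterated derivatives share a value at points where each is
    within \<open>e\<close> of its value at \<open>x\<close>, so the gap would be smaller than
    itself.\<close>
  define e where "e = \<bar>?A x - ?B x\<bar> / 2"
  have e: "e > 0" using ne by (simp add: e_def)
  have "continuous_on S ?A" "continuous_on S ?B"
    by (intro smooth_on_continuous smooth_on_frechet_derivative sm)+
  then have "isCont ?A x" "isCont ?B x"
    using assms by (simp_all add: continuous_on_eq_continuous_at)
  note cont = this[unfolded continuous_at_eps_delta, rule_format, OF e]
  obtain d1 where d1: "d1 > 0" "\<And>y. dist y x < d1 \<Longrightarrow> dist (?A y) (?A x) < e"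
    using cont(1) by blast
  obtain d2 where d2: "d2 > 0" "\<And>y. dist y x < d2 \<Longrightarrow> dist (?B y) (?B x) < e"
    using cont(2) by blast
  obtain d3 where d3: "d3 > 0" "ball x d3 \<subseteq> S" using assms open_contains_ball by blast
  define r where "r = Min {d1, d2, d3}"
  have r: "r > 0" "r \<le> d1" "r \<le> d2" "r \<le> d3" using d1 d2 d3 by (auto simp: r_def)
  \<comment> \<open>With this \<open>h\<close> the parallelogram spanned by \<open>h u\<close> and
    \<open>h v\<close> stays in the ball of radius \<open>r\<close>; the summand 1 keeps the
    denominator positive when \<open>u = v = 0\<close>.\<close>
  define h where "h = r / (2 * (norm u + norm v + 1))"
  have h: "h > 0" unfolding h_def
    by (intro divide_pos_pos mult_pos_pos r) (auto intro: add_nonneg_pos)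
  have near: "dist (x + s *\<^sub>R u + t *\<^sub>R v) x < r" if "0 \<le> s" "s \<le> h" "0 \<le> t" "t \<le> h" for s t
  proof -
    have "dist (x + s *\<^sub>R u + t *\<^sub>R v) x = norm (s *\<^sub>R u + t *\<^sub>R v)" by (simp add: dist_norm algebra_simps)
    also have "\<dots> \<le> s * norm u + t * norm v"
      using norm_triangle_ineq[of "s *\<^sub>R u" "t *\<^sub>R v"] that by simp
    also have "\<dots> \<le> h * norm u + h * norm v"
      using that by (intro add_mono mult_right_mono) auto
    also have "\<dots> < h * (2 * (norm u + norm v + 1))"
      using h by (simp add: algebra_simps) (smt (verit) mult_nonneg_nonneg norm_ge_zero)
    also have "\<dots> = r"
      unfolding h_def by (smt (verit) nonzero_eq_divide_eq norm_ge_zero)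
    finally show ?thesis .
  qed
  have mem: "x + s *\<^sub>R u + t *\<^sub>R v \<in> S" if "0 \<le> s" "s \<le> h" "0 \<le> t" "t \<le> h" for s t
    using near[OF that] r(4) d3(2) by (auto simp: dist_commute mem_ball subset_iff)
  obtain s t where 1: "0 < s" "s < h" "0 < t" "t < h"
    "f (x + h *\<^sub>R u + h *\<^sub>R v) - f (x + h *\<^sub>R u) - f (x + h *\<^sub>R v) + f x = h * h * ?A (x + s *\<^sub>R u + t *\<^sub>R v)"
    by (rule second_difference_mean_value[OF sm h mem])
  have mem': "x + s *\<^sub>R v + t *\<^sub>R u \<in> S" if "0 \<le> s" "s \<le> h" "0 \<le> t" "t \<le> h" for s t
    using mem[of t s] that by (simp add: algebra_simps)
  obtain s' t' where 2: "0 < s'" "s' < h" "0 < t'" "t' < h"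
    "f (x + h *\<^sub>R v + h *\<^sub>R u) - f (x + h *\<^sub>R v) - f (x + h *\<^sub>R u) + f x = h * h * ?B (x + s' *\<^sub>R v + t' *\<^sub>R u)"
    by (rule second_difference_mean_value[OF sm h mem'])
  have "h * h * ?A (x + s *\<^sub>R u + t *\<^sub>R v) = h * h * ?B (x + t' *\<^sub>R u + s' *\<^sub>R v)"
    using 1(5) 2(5) by (simp add: algebra_simps)
  then have eq: "?A (x + s *\<^sub>R u + t *\<^sub>R v) = ?B (x + t' *\<^sub>R u + s' *\<^sub>R v)" using h by simp
  have "dist (?A (x + s *\<^sub>R u + t *\<^sub>R v)) (?A x) < e"
    by (rule d1(2)) (use near[of s t] 1 r in linarith)
  moreover have "dist (?B (x + t' *\<^sub>R u + s' *\<^sub>R v)) (?B x) < e"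
    by (rule d2(2)) (use near[of t' s'] 2 r in linarith)
  ultimately have "dist (?A x) (?B x) < e + e"
    using eq dist_triangle2[of "?A x" "?B x" "?A (x + s *\<^sub>R u + t *\<^sub>R v)"] by (simp add: dist_commute)
  then show False by (simp only: e_def dist_real_def field_sum_of_halves less_irrefl)
qed

lemma frechet_derivative_bounded_linear:
  assumes "bounded_linear g" "f differentiable (at x)"
  shows "frechet_derivative (\<lambda>y. g (f y)) (at x) v = g (frechet_derivative f (at x) v)"
  using bounded_linear.has_derivative[OF assms(1), of f "frechet_derivative f (at x)" "at x"] assms(2)
  by (metis frechet_derivative_at frechet_derivative_works)

lemma frechet_derivative_cong:
  "open S \<Longrightarrow> x \<in> S \<Longrightarrow> (\<And>y. y \<in> S \<Longrightarrow> f y = g y) \<Longrightarrow> f differentiable (at x) \<Longrightarrow>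
   frechet_derivative g (at x) = frechet_derivative f (at x)"
  by (metis frechet_derivative_transform_within_open)

text \<open>The mean value theorem is a real statement. Real and imaginary part are bounded linear,
  so they commute with both derivatives and reduce the complex case to it.\<close>

lemma frechet_derivative_commute:
  fixes f :: "'a::real_normed_vector \<Rightarrow> complex"
  assumes "open S" and sm: "smooth_on f S" and x: "x \<in> S"
  shows "frechet_derivative (\<lambda>y. frechet_derivative f (at y) u) (at x) v =
         frechet_derivative (\<lambda>y. frechet_derivative f (at y) v) (at x) u"
proof -
  have *: "g (frechet_derivative (\<lambda>y. frechet_derivative f (at y) u) (at x) v) =
      frechet_derivative (\<lambda>y. frechet_derivative (\<lambda>y. g (f y)) (at y) u) (at x) v"
    if g: "bounded_linear g" for g :: "complex \<Rightarrow> real" and u v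
  proof -
    have "g (frechet_derivative (\<lambda>y. frechet_derivative f (at y) u) (at x) v) =
      frechet_derivative (\<lambda>y. g (frechet_derivative f (at y) u)) (at x) v"
      by (rule frechet_derivative_bounded_linear[symmetric, OF g])
        (rule smooth_on_differentiable[OF smooth_on_frechet_derivative[OF sm] x])
    also have "\<dots> = frechet_derivative (\<lambda>y. frechet_derivative (\<lambda>y. g (f y)) (at y) u) (at x) v"
    proof (rule fun_cong[OF frechet_derivative_cong[OF assms(1) x]])
      show "frechet_derivative (\<lambda>y. g (f y)) (at y) u = g (frechet_derivative f (at y) u)" if "y \<in> S" for y
        using frechet_derivative_bounded_linear[OF g smooth_on_differentiable[OF sm that]] .
      show "(\<lambda>y. frechet_derivative (\<lambda>y. g (f y)) (at y) u) differentiable at x"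
        by (intro smooth_on_differentiable[OF _ x] smooth_on_frechet_derivative
            smooth_on_bounded_linear[OF assms(1) g sm])
    qed
    finally show ?thesis .
  qed
  have "smooth_on (\<lambda>y. Re (f y)) S" "smooth_on (\<lambda>y. Im (f y)) S"
    by (intro smooth_on_bounded_linear[OF assms(1) _ sm] bounded_linear_Re bounded_linear_Im)+
  then show ?thesis
    by (intro complex_eqI)
      (simp_all only: *[OF bounded_linear_Re] *[OF bounded_linear_Im]
        frechet_derivative_commute_real[OF assms(1) _ x])
qed

section \<open>Wirtinger derivatives\<close>

text \<open>The Wirtinger derivative for the real directions \<open>u\<close> and \<open>v\<close>:
  \<open>s = - \<i>\<close> is the holomorphic one, \<open>s = \<i>\<close> its conjugate. With
  \<open>s\<close>, \<open>u\<close>, \<open>v\<close> free, one set of rules serves base and bundle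
  and both types of derivative.\<close>

definition wop :: "complex \<Rightarrow> 'a \<Rightarrow> 'a \<Rightarrow> ('a::real_normed_vector \<Rightarrow> complex) \<Rightarrow> 'a \<Rightarrow> complex" where
  "wop s u v f x = (frechet_derivative f (at x) u + s * frechet_derivative f (at x) v) / 2"

lemma wop_at:
  "(f has_derivative f') (at x) \<Longrightarrow> wop s u v f x = (f' u + s * f' v) / 2"
  unfolding wop_def by (simp add: frechet_derivative_at[symmetric])

lemma wop_cong:
  assumes "open S" "x \<in> S" "\<And>y. y \<in> S \<Longrightarrow> f y = g y"
  shows "wop s u v f x = wop s u v g x"
proof -
  have "(f has_derivative D) (at x) \<longleftrightarrow> (g has_derivative D) (at x)" for D
    using assms has_derivative_transform_within_open by (metis (no_types, lifting))
  then show ?thesis by (simp add: wop_def frechet_derivative_def)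
qed

lemma wop_add:
  assumes "f differentiable (at x)" "g differentiable (at x)"
  shows "wop s u v (\<lambda>x. f x + g x) x = wop s u v f x + wop s u v g x"
  using assms[unfolded frechet_derivative_works]
  by (subst wop_at[OF has_derivative_add]) (auto simp: wop_def field_simps)

lemma wop_diff:
  assumes "f differentiable (at x)" "g differentiable (at x)"
  shows "wop s u v (\<lambda>x. f x - g x) x = wop s u v f x - wop s u v g x"
  using assms[unfolded frechet_derivative_works]
  by (subst wop_at[OF has_derivative_diff]) (auto simp: wop_def field_simps)

lemma wop_mult:
  assumes "f differentiable (at x)" "g differentiable (at x)"
  shows "wop s u v (\<lambda>x. f x * g x) x = wop s u v f x * g x + f x * wop s u v g x"
  using assms[unfolded frechet_derivative_works]
  by (subst wop_at[OF has_derivative_mult]) (auto simp: wop_def field_simps)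

lemma wop_sum:
  assumes "\<And>i. i \<in> I \<Longrightarrow> f i differentiable (at x)"
  shows "wop s u v (\<lambda>x. \<Sum>i\<in>I. f i x) x = (\<Sum>i\<in>I. wop s u v (f i) x)"
proof -
  have "((\<lambda>x. \<Sum>i\<in>I. f i x) has_derivative (\<lambda>w. \<Sum>i\<in>I. frechet_derivative (f i) (at x) w)) (at x)"
    using assms by (intro has_derivative_sum) (simp add: frechet_derivative_works)
  from wop_at[OF this] show ?thesis
    by (simp add: wop_def sum_distrib_left sum.distrib sum_divide_distrib add_divide_distrib)
qed

lemma wop_cnj:
  assumes "f differentiable (at x)"
  shows "wop s u v (\<lambda>x. cnj (f x)) x = cnj (wop (cnj s) u v f x)"
  using assms[unfolded frechet_derivative_works]
  by (subst wop_at[OF has_derivative_cnj]) (auto simp: wop_def)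

lemma smooth_on_wop [simp]: "open S \<Longrightarrow> smooth_on f S \<Longrightarrow> smooth_on (wop s u v f) S"
  unfolding wop_def[abs_def] divide_inverse
  by (intro smooth_on_mult smooth_on_add smooth_on_const smooth_on_frechet_derivative)

lemma wop_commute:
  assumes "open S" "smooth_on f S" "x \<in> S"
  shows "wop s u v (wop s' u' v' f) x = wop s' u' v' (wop s u v f) x"
proof -
  have *: "frechet_derivative (wop s u v f) (at x) w =
     (frechet_derivative (\<lambda>y. frechet_derivative f (at y) w) (at x) u +
      s * frechet_derivative (\<lambda>y. frechet_derivative f (at y) w) (at x) v) / 2" for s u v w
  proof -
    have D: "((\<lambda>y. frechet_derivative f (at y) u) has_derivative
        frechet_derivative (\<lambda>y. frechet_derivative f (at y) u) (at x)) (at x)" for u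
      by (rule smooth_on_has_derivative[OF smooth_on_frechet_derivative[OF assms(2)] assms(3)])
    have "(wop s u v f has_derivative (\<lambda>w. (frechet_derivative (\<lambda>y. frechet_derivative f (at y) u) (at x) w
       + s * frechet_derivative (\<lambda>y. frechet_derivative f (at y) v) (at x) w) / 2)) (at x)"
      unfolding wop_def[abs_def]
      by (rule bounded_linear.has_derivative[OF bounded_linear_divide])
        (intro has_derivative_add has_derivative_mult_right D)
    from fun_cong[OF frechet_derivative_at[OF this], of w, symmetric] show ?thesis
      by (simp add: frechet_derivative_commute[OF assms])
  qed
  show ?thesis
    unfolding wop_def[of s u v "wop s' u' v' f"] wop_def[of s' u' v' "wop s u v f"] * 
    by (simp add: frechet_derivative_commute[OF assms, of u'] frechet_derivative_commute[OF assms, of v'] field_simps)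
qed

section \<open>Holomorphic and antiholomorphic derivatives in coordinates\<close>

abbreviation pz :: "'n \<Rightarrow> (complex^'n::finite \<Rightarrow> complex) \<Rightarrow> complex^'n \<Rightarrow> complex" where
  "pz k \<equiv> wop (- \<i>) (axis k 1) (axis k \<i>)"

abbreviation pzb :: "'n \<Rightarrow> (complex^'n::finite \<Rightarrow> complex) \<Rightarrow> complex^'n \<Rightarrow> complex" where
  "pzb k \<equiv> wop \<i> (axis k 1) (axis k \<i>)"

lemma vec_complex_basis:
  fixes w :: "complex^'n::finite"
  shows "w = (\<Sum>k\<in>UNIV. Re (w $ k) *\<^sub>R axis k 1 + Im (w $ k) *\<^sub>R axis k \<i>)"
proof -
  have "(\<Sum>k\<in>UNIV. Re (w $ k) *\<^sub>R axis k 1 + Im (w $ k) *\<^sub>R axis k \<i>) $ j = w $ j" for j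
  proof -
    have "(\<Sum>k\<in>UNIV. Re (w $ k) *\<^sub>R axis k (1::complex) + Im (w $ k) *\<^sub>R axis k \<i>) $ j =
       (\<Sum>k\<in>UNIV. if k = j then w $ k else 0)"
      by (simp only: sum_component, intro sum.cong) (auto simp: axis_def complex_eq_iff)
    then show ?thesis by simp
  qed
  then show ?thesis by (simp add: vec_eq_iff)
qed

text \<open>The split into a complex linear and a conjugate linear part. It shows that vanishing
  Wirtinger derivatives make the whole derivative vanish, and it yields the chain rule along
  holomorphic curves.\<close>

lemma frechet_derivative_wirtinger:
  fixes f :: "complex^'n::finite \<Rightarrow> complex"
  assumes "f differentiable (at z)"
  shows "frechet_derivative f (at z) w = (\<Sum>k\<in>UNIV. pz k f z * w $ k + pzb k f z * cnj (w $ k))"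
proof -
  let ?D = "frechet_derivative f (at z)"
  have lin: "linear ?D" by (rule linear_frechet_derivative[OF assms])
  have "?D w = (\<Sum>k\<in>UNIV. Re (w $ k) *\<^sub>R ?D (axis k 1) + Im (w $ k) *\<^sub>R ?D (axis k \<i>))"
    by (subst vec_complex_basis[of w]) (simp add: linear_sum[OF lin] linear_add[OF lin] linear_cmul[OF lin])
  also have "\<dots> = (\<Sum>k\<in>UNIV. pz k f z * w $ k + pzb k f z * cnj (w $ k))"
  proof (rule sum.cong[OF refl])
    fix k
    have "(a - \<i> * b) / 2 * w $ k + (a + \<i> * b) / 2 * cnj (w $ k) = Re (w $ k) *\<^sub>R a + Im (w $ k) *\<^sub>R b" for a b
      by (simp add: complex_eq_iff field_simps)
    then show "Re (w $ k) *\<^sub>R ?D (axis k 1) + Im (w $ k) *\<^sub>R ?D (axis k \<i>) = pz k f z * w $ k + pzb k f z * cnj (w $ k)"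
      by (simp add: wop_def)
  qed
  finally show ?thesis .
qed

section \<open>Polarisation in dimension two\<close>

lemma poly_real_line:
  fixes c :: "nat \<Rightarrow> complex"
  assumes "\<And>r::real. (\<Sum>i\<le>n. c i * of_real r ^ i) = 0" "i \<le> n"
  shows "c i = 0"
proof (rule ccontr)
  assume "c i \<noteq> 0"
  then have "finite {z. (\<Sum>i\<le>n. c i * z ^ i) = 0}"
    using polyfun_finite_roots[of c n] assms(2) by blast
  moreover have "range complex_of_real \<subseteq> {z. (\<Sum>i\<le>n. c i * z ^ i) = 0}"
    using assms(1) by auto
  ultimately have "finite (range complex_of_real)" by (rule finite_subset[rotated])
  then show False
    using finite_imageD[of complex_of_real UNIV] by (simp add: inj_of_real infinite_UNIV_char_0)
qed

lemma quartic_real_line: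
  fixes a b c d e :: complex
  assumes "\<And>r::real. a + b * of_real r + c * of_real r ^ 2 + d * of_real r ^ 3 + e * of_real r ^ 4 = 0"
  shows "a = 0" "b = 0" "c = 0" "d = 0" "e = 0"
proof -
  define f where "f = (\<lambda>i::nat. if i = 0 then a else if i = 1 then b else if i = 2 then c else if i = 3 then d else e)"
  have f: "f i = 0" if "i \<le> 4" for i
    using assms that
    by (intro poly_real_line[where n = 4 and c = f]) (simp_all add: f_def eval_nat_numeral algebra_simps)
  show "a = 0" "b = 0" "c = 0" "d = 0" "e = 0"
    using f[of 0] f[of 1] f[of 2] f[of 3] f[of 4] by (simp_all add: f_def)
qed

text \<open>On the real line \<open>t = cnj t\<close>, on the imaginary axis \<open>t = - cnj t\<close>; the two resulting
  polynomials determine both coefficient families.\<close>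

lemma cubic_plus_cnj_cubic:
  fixes p0 p1 p2 p3 q0 q1 q2 q3 :: complex
  assumes "\<And>t::complex. p0 + p1 * t + p2 * t ^ 2 + p3 * t ^ 3 +
     cnj t * (q0 + q1 * t + q2 * t ^ 2 + q3 * t ^ 3) = 0"
  shows "p0 = 0 \<and> p1 = 0 \<and> p2 = 0 \<and> p3 = 0 \<and> q0 = 0 \<and> q1 = 0 \<and> q2 = 0 \<and> q3 = 0"
proof -
  have 1: "p0 + (p1 + q0) * of_real r + (p2 + q1) * of_real r ^ 2 + (p3 + q2) * of_real r ^ 3 + q3 * of_real r ^ 4 = 0"
    for r :: real
    using assms[of "of_real r"] by (simp add: algebra_simps eval_nat_numeral)
  have 2: "p0 + (\<i> * (p1 - q0)) * of_real r + (q1 - p2) * of_real r ^ 2 + (\<i> * (q2 - p3)) * of_real r ^ 3 + - q3 * of_real r ^ 4 = 0"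
    for r :: real
    using assms[of "\<i> * of_real r"] by (simp add: algebra_simps eval_nat_numeral)
  note q1 = quartic_real_line[OF 1] note q2 = quartic_real_line[OF 2]
  have "p1 = q0" "q1 = p2" "q2 = p3" using q2 by simp_all
  with q1 show ?thesis by simp
qed

text \<open>The same with the third line \<open>cnj t = - \<i> * t\<close>.\<close>

lemma biquadratic_vanish:
  fixes a b c d e f g h k :: complex
  assumes "\<And>t::complex. a + b * t + c * t ^ 2 + cnj t * (d + e * t + f * t ^ 2) +
     cnj t ^ 2 * (g + h * t + k * t ^ 2) = 0"
  shows "a = 0 \<and> b = 0 \<and> c = 0 \<and> d = 0 \<and> e = 0 \<and> f = 0 \<and> g = 0 \<and> h = 0 \<and> k = 0"
proof -
  have 1: "a + (b + d) * of_real r + (c + e + g) * of_real r ^ 2 + (f + h) * of_real r ^ 3 + k * of_real r ^ 4 = 0"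
    for r :: real
    using assms[of "of_real r"] by (simp add: algebra_simps eval_nat_numeral)
  have 2: "a + (\<i> * (b - d)) * of_real r + (e - c - g) * of_real r ^ 2 + (\<i> * (f - h)) * of_real r ^ 3 + k * of_real r ^ 4 = 0"
    for r :: real
    using assms[of "\<i> * of_real r"] by (simp add: algebra_simps eval_nat_numeral)
  have 3: "a + (b * (1 + \<i>) + d * (1 - \<i>)) * of_real r + 2 * (\<i> * c + e - \<i> * g) * of_real r ^ 2 +
     2 * (f * (1 + \<i>) + h * (1 - \<i>)) * of_real r ^ 3 + 4 * k * of_real r ^ 4 = 0"
    for r :: real
    using assms[of "(1 + \<i>) * of_real r"] by (simp add: algebra_simps eval_nat_numeral)
  note q1 = quartic_real_line[OF 1] note q2 = quartic_real_line[OF 2] note q3 = quartic_real_line[OF 3]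
  have bd: "b = 0" "d = 0" "f = 0" "h = 0" using q1(2,4) q2(2,4) by (auto simp: add_eq_0_iff)
  have e: "e = 0" using q1(3) q2(3) by algebra
  have "c + g = 0" "\<i> * (c - g) = 0" using q1(3) q3(3) e by (auto simp: algebra_simps)
  then have "c = 0" "g = 0" by (auto simp: add_eq_0_iff)
  with bd e q1 show ?thesis by simp
qed

text \<open>Subtracting the model leaves a tensor \<open>W\<close> with the same symmetries, which
  cut sixteen components down to nine. On \<open>(1, t)\<close> its quartic form has bidegree (2, 2)
  in \<open>t\<close> and \<open>cnj t\<close>, and the nine coefficients are these components up to
  positive multiplicities.\<close>

lemma curvature_tensor_of_quartic:
  fixes R :: "2 \<Rightarrow> 2 \<Rightarrow> 2 \<Rightarrow> 2 \<Rightarrow> complex" and g :: "2 \<Rightarrow> 2 \<Rightarrow> complex"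
  assumes sym: "\<And>j m k h. R j m k h = R k m j h" "\<And>j m k h. R j m k h = R j h k m"
    and eq: "\<And>v :: complex^2. v \<noteq> 0 \<Longrightarrow>
      (\<Sum>j\<in>UNIV. \<Sum>m\<in>UNIV. \<Sum>k\<in>UNIV. \<Sum>h\<in>UNIV. R j m k h * v $ j * cnj (v $ m) * v $ k * cnj (v $ h)) =
      2 * c * (\<Sum>j\<in>UNIV. \<Sum>m\<in>UNIV. g j m * v $ j * cnj (v $ m))\<^sup>2"
  shows "R j m k h = c * (g j m * g k h + g j h * g k m)"
proof -
  define W where "W j m k h = R j m k h - c * (g j m * g k h + g j h * g k m)" for j m k h
  have Ws: "W j m k h = W k m j h" "W j m k h = W j h k m" for j m k h
    using sym[of j m k h] by (simp_all add: W_def algebra_simps)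
  have "W 1 1 1 1 + (2 * W 1 1 2 1) * t + W 2 1 2 1 * t ^ 2 +
      cnj t * (2 * W 1 1 1 2 + (4 * W 1 1 2 2) * t + (2 * W 2 1 2 2) * t ^ 2) +
      cnj t ^ 2 * (W 1 2 1 2 + (2 * W 1 2 2 2) * t + W 2 2 2 2 * t ^ 2) = 0" for t
  proof -
    have "(vector [1, t] :: complex^2) \<noteq> 0" by (simp add: vec_eq_iff forall_2)
    from eq[OF this] show ?thesis
      using sym(1)[of 1 1 2 1] sym(1)[of 1 1 2 2] sym(1)[of 1 2 2 1] sym(1)[of 1 2 2 2]
        sym(2)[of 1 1 1 2] sym(2)[of 1 1 2 2] sym(2)[of 2 1 1 2] sym(2)[of 2 1 2 2]
      by (simp add: W_def sum_2 algebra_simps power2_eq_square)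
  qed
  note 0 = biquadratic_vanish[OF this]
  have Z: "W 1 1 1 1 = 0" "W 1 1 1 2 = 0" "W 1 1 2 1 = 0" "W 1 1 2 2 = 0"
    "W 1 2 1 1 = 0" "W 1 2 1 2 = 0" "W 1 2 2 1 = 0" "W 1 2 2 2 = 0"
    "W 2 1 1 1 = 0" "W 2 1 1 2 = 0" "W 2 1 2 1 = 0" "W 2 1 2 2 = 0"
    "W 2 2 1 1 = 0" "W 2 2 1 2 = 0" "W 2 2 2 1 = 0" "W 2 2 2 2 = 0"
    using 0 Ws(1)[of 1 1 2 1] Ws(1)[of 1 1 2 2] Ws(1)[of 1 2 2 1] Ws(1)[of 1 2 2 2]
      Ws(2)[of 1 1 1 2] Ws(2)[of 2 1 1 2] Ws(2)[of 1 1 2 2] Ws(2)[of 2 1 2 2]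
    by simp_all
  have "W j m k h = 0"
    using exhaust_2[of j] exhaust_2[of m] exhaust_2[of k] exhaust_2[of h]
    by (elim disjE) (simp_all only: Z)
  then show ?thesis by (simp add: W_def)
qed

text \<open>The hypothesis says that the covectors \<open>R(v, v, v, .)\<close> and
  \<open>g(v, .)\<close> are parallel. It is linear in \<open>R\<close> and holds for the model,
  hence for the difference \<open>W\<close>. On \<open>(1, t)\<close> it has bidegree (3, 1), which
  gives eight equations for the eight independent components other than \<open>W 1 1 1 1\<close>;
  nondegeneracy of \<open>g\<close> leaves only the zero solution.\<close>

lemma curvature_tensor_of_proportional:
  fixes R :: "2 \<Rightarrow> 2 \<Rightarrow> 2 \<Rightarrow> 2 \<Rightarrow> complex" and g :: "2 \<Rightarrow> 2 \<Rightarrow> complex"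
  assumes sym: "\<And>j m k h. R j m k h = R k m j h" "\<And>j m k h. R j m k h = R j h k m"
    and g11: "g 1 1 \<noteq> 0" and det: "g 1 1 * g 2 2 - g 1 2 * g 2 1 \<noteq> 0"
    and eq: "\<And>v :: complex^2. v \<noteq> 0 \<Longrightarrow>
      (\<Sum>j\<in>UNIV. \<Sum>m\<in>UNIV. \<Sum>k\<in>UNIV. R j m k 1 * v $ j * cnj (v $ m) * v $ k) * (\<Sum>j\<in>UNIV. g j 2 * v $ j) =
      (\<Sum>j\<in>UNIV. \<Sum>m\<in>UNIV. \<Sum>k\<in>UNIV. R j m k 2 * v $ j * cnj (v $ m) * v $ k) * (\<Sum>j\<in>UNIV. g j 1 * v $ j)"
  shows "R j m k h = R 1 1 1 1 / (2 * (g 1 1)\<^sup>2) * (g j m * g k h + g j h * g k m)"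
proof -
  \<comment> \<open>The choice that makes \<open>W 1 1 1 1\<close> vanish.\<close>
  define c where "c = R 1 1 1 1 / (2 * (g 1 1)\<^sup>2)"
  define W where "W j m k h = R j m k h - c * (g j m * g k h + g j h * g k m)" for j m k h
  have Ws: "W j m k h = W k m j h" "W j m k h = W j h k m" for j m k h
    using sym[of j m k h] by (simp_all add: W_def algebra_simps)
  have W1: "W 1 1 1 1 = 0" using g11 by (simp add: W_def c_def power2_eq_square)
  have "(W 1 1 1 1 * g 1 2 - W 1 1 1 2 * g 1 1) +
      (W 1 1 1 1 * g 2 2 + 2 * W 1 1 2 1 * g 1 2 - W 1 1 1 2 * g 2 1 - 2 * W 1 1 2 2 * g 1 1) * t +
      (2 * W 1 1 2 1 * g 2 2 + W 2 1 2 1 * g 1 2 - 2 * W 1 1 2 2 * g 2 1 - W 2 1 2 2 * g 1 1) * t ^ 2 +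
      (W 2 1 2 1 * g 2 2 - W 2 1 2 2 * g 2 1) * t ^ 3 + cnj t *
     ((W 1 1 1 2 * g 1 2 - W 1 2 1 2 * g 1 1) +
      (W 1 1 1 2 * g 2 2 + 2 * W 1 1 2 2 * g 1 2 - W 1 2 1 2 * g 2 1 - 2 * W 1 2 2 2 * g 1 1) * t +
      (2 * W 1 1 2 2 * g 2 2 + W 2 1 2 2 * g 1 2 - 2 * W 1 2 2 2 * g 2 1 - W 2 2 2 2 * g 1 1) * t ^ 2 +
      (W 2 1 2 2 * g 2 2 - W 2 2 2 2 * g 2 1) * t ^ 3) = 0" for t
  proof -
    have "(vector [1, t] :: complex^2) \<noteq> 0" by (simp add: vec_eq_iff forall_2)
    from eq[OF this] show ?thesis
      using sym(1)[of 1 1 2 1] sym(1)[of 1 1 2 2] sym(1)[of 1 2 2 1] sym(1)[of 1 2 2 2]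
        sym(2)[of 1 1 1 2] sym(2)[of 1 1 2 2] sym(2)[of 2 1 1 2] sym(2)[of 2 1 2 2]
      by (simp add: W_def sum_2 algebra_simps power2_eq_square power3_eq_cube)
  qed
  note E = cubic_plus_cnj_cubic[OF this, unfolded W1]
  have a: "W 1 1 1 2 = 0" using E g11 by simp
  have b: "W 1 2 1 2 = 0" using E g11 a by simp
  have 1: "W 1 1 2 1 * g 1 2 = W 1 1 2 2 * g 1 1" "W 1 1 2 2 * g 1 2 = W 1 2 2 2 * g 1 1"
    using E a b by simp_all
  have 2: "2 * W 1 1 2 1 * g 2 2 + W 2 1 2 1 * g 1 2 = 2 * W 1 1 2 2 * g 2 1 + W 2 1 2 2 * g 1 1"
    "2 * W 1 1 2 2 * g 2 2 + W 2 1 2 2 * g 1 2 = 2 * W 1 2 2 2 * g 2 1 + W 2 2 2 2 * g 1 1"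
    "W 2 1 2 1 * g 2 2 = W 2 1 2 2 * g 2 1" "W 2 1 2 2 * g 2 2 = W 2 2 2 2 * g 2 1"
    using E by (simp_all add: algebra_simps)
  let ?D = "g 1 1 * g 2 2 - g 1 2 * g 2 1"
  \<comment> \<open>Multiplication by \<open>?D\<close> expresses \<open>W 1 1 2 1\<close> and
    \<open>W 1 1 2 2\<close> through the components with \<open>j = k = 2\<close>.\<close>
  have 3: "2 * W 1 1 2 1 * ?D = g 1 1 * (W 2 1 2 2 * g 1 1 - W 2 1 2 1 * g 1 2)"
    using 1(1) 2(1) by algebra
  have 4: "2 * W 1 1 2 2 * ?D = g 1 1 * (W 2 2 2 2 * g 1 1 - W 2 1 2 2 * g 1 2)"
    using 1(2) 2(2) by algebra
  have "g 1 1 * (g 1 2 * (W 2 1 2 2 * g 1 1 - W 2 1 2 1 * g 1 2)) =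
        g 1 1 * (g 1 1 * (W 2 2 2 2 * g 1 1 - W 2 1 2 2 * g 1 2))"
    using 1(1) 3 4 by algebra
  then have 5: "g 1 2 * (W 2 1 2 2 * g 1 1 - W 2 1 2 1 * g 1 2) = g 1 1 * (W 2 2 2 2 * g 1 1 - W 2 1 2 2 * g 1 2)"
    using g11 by (subst (asm) mult_left_cancel) auto
  \<comment> \<open>Relation 5 is a quadratic expression in \<open>g 1 1\<close> and
    \<open>g 1 2\<close> whose coefficients are the three remaining components. By the last two
    equations of 2 these behave like \<open>(g 2 1)^2\<close>, \<open>g 2 1 * g 2 2\<close>,
    \<open>(g 2 2)^2\<close>, for which the expression is the square of \<open>?D\<close>.\<close>
  have "W 2 1 2 1 * ?D ^ 2 = 0" using 5 2(3,4) by algebra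
  then have d: "W 2 1 2 1 = 0" using det by auto
  have e: "W 2 1 2 2 = 0"
  proof (rule ccontr)
    assume ne: "W 2 1 2 2 \<noteq> 0"
    have "g 2 1 = 0" using 2(3) d ne by simp
    moreover then have "g 2 2 = 0" using 2(4) ne by simp
    ultimately show False using det by simp
  qed
  have f: "W 2 2 2 2 = 0" using 5 d e g11 by simp
  have h: "W 1 1 2 1 = 0" "W 1 1 2 2 = 0" using 3 4 d e f det by simp_all
  have k: "W 1 2 2 2 = 0" using 1 h g11 by simp
  have Z: "W 1 1 1 1 = 0" "W 1 1 1 2 = 0" "W 1 1 2 1 = 0" "W 1 1 2 2 = 0"
    "W 1 2 1 1 = 0" "W 1 2 1 2 = 0" "W 1 2 2 1 = 0" "W 1 2 2 2 = 0"
    "W 2 1 1 1 = 0" "W 2 1 1 2 = 0" "W 2 1 2 1 = 0" "W 2 1 2 2 = 0"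
    "W 2 2 1 1 = 0" "W 2 2 1 2 = 0" "W 2 2 2 1 = 0" "W 2 2 2 2 = 0"
    using W1 a b d e f h k Ws(1)[of 1 1 2 1] Ws(1)[of 1 1 2 2] Ws(1)[of 1 2 2 1] Ws(1)[of 1 2 2 2]
      Ws(2)[of 1 1 1 2] Ws(2)[of 2 1 1 2] Ws(2)[of 1 1 2 2] Ws(2)[of 2 1 2 2]
    by simp_all
  have "W j m k h = 0"
    using exhaust_2[of j] exhaust_2[of m] exhaust_2[of k] exhaust_2[of h]
    by (elim disjE) (simp_all only: Z)
  then show ?thesis by (simp add: W_def c_def)
qed

section \<open>Kaehler metrics in a chart\<close>

locale hermitian_chart =
  fixes U :: "(complex^2) set" and g :: "2 \<Rightarrow> 2 \<Rightarrow> complex^2 \<Rightarrow> complex"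
  assumes open_U: "open U"
    and smooth_g: "smooth_on (g i j) U"
    and herm: "z \<in> U \<Longrightarrow> cnj (g i j z) = g j i z"
    and pos: "z \<in> U \<Longrightarrow> v \<noteq> 0 \<Longrightarrow> 0 < Re (\<Sum>i\<in>UNIV. \<Sum>j\<in>UNIV. g i j z * v $ i * cnj (v $ j))"
begin

definition A :: "2 \<Rightarrow> 2 \<Rightarrow> 2 \<Rightarrow> complex^2 \<Rightarrow> complex" where
  "A k j m = pz k (g j m)"

definition gdet :: "complex^2 \<Rightarrow> complex" where
  "gdet z = g 1 1 z * g 2 2 z - g 1 2 z * g 2 1 z"

text \<open>Cramer's rule is written out so that smoothness is visible; as in \<open>ginv\<close>,
  the first index is the conjugate one.\<close>

definition gi :: "2 \<Rightarrow> 2 \<Rightarrow> complex^2 \<Rightarrow> complex" where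
  "gi m i z = (if m = 1 then if i = 1 then g 2 2 z else - g 1 2 z
     else if i = 1 then - g 2 1 z else g 1 1 z) * inverse (gdet z)"

definition Gam :: "2 \<Rightarrow> 2 \<Rightarrow> 2 \<Rightarrow> complex^2 \<Rightarrow> complex" where
  "Gam i j k z = (\<Sum>l\<in>UNIV. gi l i z * A k j l z)"

text \<open>The Chern curvature of the metric with all indices lowered. The inverse metric in the
  quadratic term is absorbed into the conjugate connection.\<close>

definition R :: "2 \<Rightarrow> 2 \<Rightarrow> 2 \<Rightarrow> 2 \<Rightarrow> complex^2 \<Rightarrow> complex" where
  "R j m k h z = (\<Sum>r\<in>UNIV. cnj (Gam r m h z) * A k j r z) - pzb h (A k j m) z"

lemma diffU: "smooth_on f U \<Longrightarrow> z \<in> U \<Longrightarrow> f differentiable (at z)"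
  by (rule smooth_on_differentiable)

declare open_U [simp] smooth_g [simp]

lemma congU: "z \<in> U \<Longrightarrow> (\<And>y. y \<in> U \<Longrightarrow> f y = f' y) \<Longrightarrow> wop s u v f z = wop s u v f' z"
  by (rule wop_cong[OF open_U])

lemma g11_nonzero: "z \<in> U \<Longrightarrow> g 1 1 z \<noteq> 0"
proof
  assume "z \<in> U" "g 1 1 z = 0"
  moreover have "(\<Sum>i\<in>UNIV. \<Sum>j\<in>UNIV. g i j z * axis 1 1 $ i * cnj ((axis 1 1 :: complex^2) $ j)) = g 1 1 z"
    by (simp add: sum_2 axis_def)
  ultimately show False using pos[of z "axis 1 1"] by (simp add: axis_eq_0_iff)
qed

lemma gdet_nonzero: assumes "z \<in> U" shows "gdet z \<noteq> 0"
proof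
  assume 0: "gdet z = 0"
  \<comment> \<open>This vector spans the kernel when \<open>gdet z = 0\<close>; in general its
    squared norm is \<open>gdet z * cnj (g 1 1 z)\<close>.\<close>
  have v: "(vector [g 2 1 z, - g 1 1 z] :: complex^2) \<noteq> 0"
    using g11_nonzero[OF assms] by (simp add: vec_eq_iff forall_2)
  have "(\<Sum>i\<in>UNIV. \<Sum>j\<in>UNIV. g i j z * (vector [g 2 1 z, - g 1 1 z] :: complex^2) $ i *
     cnj ((vector [g 2 1 z, - g 1 1 z] :: complex^2) $ j)) = gdet z * cnj (g 1 1 z)"
    by (simp add: sum_2 gdet_def algebra_simps)
  with pos[OF assms v] 0 show False by simp
qed

lemma smooth_A [simp]: "smooth_on (A k j m) U"
  unfolding A_def by simp

lemma smooth_gi [simp]: "smooth_on (gi m i) U"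
proof -
  have "smooth_on (\<lambda>z. if b then f z else f' z) U" if "smooth_on f U" "smooth_on f' U" for b and f f' :: "complex^2 \<Rightarrow> complex"
    using that by (cases b) simp_all
  moreover have "smooth_on (\<lambda>z. inverse (gdet z)) U"
    by (rule smooth_on_inverse) (use gdet_nonzero in \<open>simp_all add: gdet_def[abs_def]\<close>)
  ultimately show ?thesis unfolding gi_def[abs_def]
    by (intro smooth_on_mult) simp_all
qed

lemma smooth_Gam [simp]: "smooth_on (Gam i j k) U"
  unfolding Gam_def[abs_def] by simp

lemma smooth_R [simp]: "smooth_on (R j m k h) U"
  unfolding R_def[abs_def] by simp

lemma gdet_inverse:
  assumes "z \<in> U"
  shows "g 1 1 z * g 2 2 z * inverse (gdet z) = 1 + g 1 2 z * g 2 1 z * inverse (gdet z)"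
proof -
  have "gdet z * inverse (gdet z) = 1" using gdet_nonzero[OF assms] by simp
  then show ?thesis by (subst (asm) (1) gdet_def) (simp add: left_diff_distrib diff_eq_eq)
qed

lemma g_gi: "z \<in> U \<Longrightarrow> (\<Sum>m\<in>UNIV. g j m z * gi m i z) = (if j = i then 1 else 0)"
  using gdet_inverse[of z] exhaust_2[of i] exhaust_2[of j]
  by (auto simp: sum_2 gi_def algebra_simps)

lemma gi_g: "z \<in> U \<Longrightarrow> (\<Sum>i\<in>UNIV. gi l i z * g i m z) = (if l = m then 1 else 0)"
  using gdet_inverse[of z] exhaust_2[of l] exhaust_2[of m]
  by (auto simp: sum_2 gi_def algebra_simps)

lemma gi_herm: "z \<in> U \<Longrightarrow> cnj (gi m i z) = gi i m z"
  using exhaust_2[of i] exhaust_2[of m] by (auto simp: gi_def herm gdet_def mult.commute)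

lemma lower_Gam: assumes "z \<in> U" shows "(\<Sum>i\<in>UNIV. Gam i j k z * g i m z) = A k j m z"
proof -
  have "(\<Sum>i\<in>UNIV. Gam i j k z * g i m z) = (\<Sum>l\<in>UNIV. A k j l z * (\<Sum>i\<in>UNIV. gi l i z * g i m z))"
    by (simp add: sum_2 Gam_def algebra_simps)
  then show ?thesis using assms by (simp add: gi_g if_distrib[of "(*) _"] cong: if_cong)
qed

lemma cnj_A: assumes "z \<in> U" shows "cnj (A k j m z) = pzb k (g m j) z"
proof -
  have "cnj (A k j m z) = pzb k (\<lambda>z. cnj (g j m z)) z"
    using assms by (simp add: wop_cnj diffU A_def)
  also have "\<dots> = pzb k (g m j) z"
    by (rule congU[OF assms]) (simp add: herm)
  finally show ?thesis .
qed

lemma lower_Gam_cnj: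
  "z \<in> U \<Longrightarrow> (\<Sum>r\<in>UNIV. g s r z * cnj (Gam r m h z)) = pzb h (g s m) z"
  using lower_Gam[of z m h s, symmetric] by (simp add: cnj_A[symmetric] herm mult.commute)

end

locale kaehler_chart = hermitian_chart +
  assumes kaehler: "z \<in> U \<Longrightarrow> pz k (g j m) z = pz j (g k m) z"
begin

lemma A_sym: "z \<in> U \<Longrightarrow> A k j m z = A j k m z"
  unfolding A_def by (rule kaehler)

lemma Gam_sym: "z \<in> U \<Longrightarrow> Gam i j k z = Gam i k j z"
  unfolding Gam_def using A_sym by simp

lemma R_sym1: assumes "z \<in> U" shows "R j m k h z = R k m j h z"
proof -
  have "pzb h (A k j m) z = pzb h (A j k m) z"
    by (rule congU[OF assms]) (rule A_sym)
  then show ?thesis using assms A_sym by (simp add: R_def)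
qed

lemma pzb_A: "z \<in> U \<Longrightarrow> pzb h (A k j m) z = pz k (pzb h (g j m)) z"
  unfolding A_def by (rule wop_commute) simp_all

text \<open>Commuting the derivatives turns the second-order term into a derivative of
  \<open>pzb h (g j m)\<close>, where \<open>h\<close> and \<open>m\<close> may be exchanged by the
  conjugated Kaehler condition.\<close>

lemma R_sym2: assumes "z \<in> U" shows "R j m k h z = R j h k m z"
proof -
  have *: "pzb h (g j m) y = pzb m (g j h) y" if "y \<in> U" for y
    using cnj_A[of y h m j] cnj_A[of y m h j] A_sym[of y h m j] that by simp
  have "pzb h (A k j m) z = pzb m (A k j h) z"
    unfolding pzb_A[OF assms] by (rule congU[OF assms]) (rule *)
  then show ?thesis using assms Gam_sym by (simp add: R_def)
qed

text \<open>This component determines the curvature factor, so its reality makes the factor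
  real.\<close>

lemma R_1111_real: assumes "z \<in> U" shows "cnj (R 1 1 1 1 z) = R 1 1 1 1 z"
proof -
  have "cnj (pzb 1 (A 1 1 1) z) = pz 1 (\<lambda>z. cnj (A 1 1 1 z)) z"
    using assms by (simp add: wop_cnj diffU)
  also have "\<dots> = pzb 1 (A 1 1 1) z"
    unfolding pzb_A[OF assms] by (rule congU[OF assms]) (rule cnj_A)
  finally show ?thesis
    using assms by (simp add: R_def Gam_def sum_2 gi_herm algebra_simps)
qed

text \<open>The second Bianchi identity with the connection terms that are already symmetric left out.\<close>

lemma bianchi:
  assumes z: "z \<in> U"
  shows "pz l (R j m k h) z + (\<Sum>r\<in>UNIV. Gam r j k z * R r m l h z) =
         pz j (R l m k h) z + (\<Sum>r\<in>UNIV. Gam r l k z * R r m j h z)"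
proof -
  \<comment> \<open>Differentiating \<open>lower_Gam_cnj\<close> along \<open>z^l\<close> shows that
    the holomorphic derivative of the conjugate connection is minus the curvature.\<close>
  have X: "(\<Sum>r\<in>UNIV. g s r z * pz l (\<lambda>z. cnj (Gam r m h z)) z) = - R s m l h z" for s l
  proof -
    have "pz l (\<lambda>y. \<Sum>r\<in>UNIV. g s r y * cnj (Gam r m h y)) z = pzb h (A l s m) z"
      unfolding pzb_A[OF z] by (rule congU[OF z]) (rule lower_Gam_cnj)
    then show ?thesis using z
      by (simp add: wop_sum wop_mult diffU sum.distrib R_def A_def[symmetric] mult.commute algebra_simps)
  qed
  have Y: "(\<Sum>r\<in>UNIV. pz l (\<lambda>z. cnj (Gam r m h z)) z * A k j r z) = - (\<Sum>s\<in>UNIV. Gam s j k z * R s m l h z)" for l j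
  proof -
    have "(\<Sum>r\<in>UNIV. pz l (\<lambda>z. cnj (Gam r m h z)) z * A k j r z) =
      (\<Sum>s\<in>UNIV. Gam s j k z * (\<Sum>r\<in>UNIV. g s r z * pz l (\<lambda>z. cnj (Gam r m h z)) z))"
      by (simp only: lower_Gam[OF z, of j k, symmetric]) (simp add: sum_2 algebra_simps)
    then show ?thesis by (simp add: X sum_negf)
  qed
  \<comment> \<open>\<open>Y\<close> cancels the connection sum on the left. What remains contains
    \<open>l\<close> and \<open>j\<close> only through \<open>pz l (A k j _)\<close>, which is
    symmetric in them.\<close>
  have Z: "pz l (R j m k h) z + (\<Sum>r\<in>UNIV. Gam r j k z * R r m l h z) =
     (\<Sum>r\<in>UNIV. cnj (Gam r m h z) * pz l (A k j r) z) - pzb h (pz l (A k j m)) z" for l j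
  proof -
    have "pz l (R j m k h) z = (\<Sum>r\<in>UNIV. pz l (\<lambda>z. cnj (Gam r m h z)) z * A k j r z) +
      (\<Sum>r\<in>UNIV. cnj (Gam r m h z) * pz l (A k j r) z) - pz l (pzb h (A k j m)) z"
      unfolding R_def[abs_def] using z
      by (simp add: wop_diff wop_sum wop_mult diffU sum.distrib)
    moreover have "pz l (pzb h (A k j m)) z = pzb h (pz l (A k j m)) z"
      by (rule wop_commute) (use z in simp_all)
    ultimately show ?thesis by (simp add: Y)
  qed
  have S: "pz l (A k j r) y = pz j (A k l r) y" if "y \<in> U" for y r
  proof -
    have "pz l (A k j r) y = pz l (A j k r) y" by (rule congU[OF that]) (rule A_sym)
    also have "\<dots> = pz j (A l k r) y" unfolding A_def by (rule wop_commute) (use that in simp_all)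
    also have "\<dots> = pz j (A k l r) y" by (rule congU[OF that]) (rule A_sym)
    finally show ?thesis .
  qed
  have "pzb h (pz l (A k j m)) z = pzb h (pz j (A k l m)) z"
    by (rule congU[OF z]) (rule S)
  then show ?thesis using S[OF z] by (simp add: Z)
qed

text \<open>In the Bianchi identity for the model form, the connection terms agree on both sides by
  symmetry of \<open>A\<close>, and only derivatives of \<open>c\<close> survive. Two different
  indices and nondegeneracy of \<open>g\<close> then force these to vanish; this is where dimension
  at least two enters.\<close>

lemma schur:
  assumes R: "\<And>z j m k h. z \<in> U \<Longrightarrow> R j m k h z = c z * (g j m z * g k h z + g j h z * g k m z)"
    and z: "z \<in> U"
  shows "(c has_derivative (\<lambda>v. 0)) (at z)" and "cnj (c z) = c z"
proof -
  \<comment> \<open>The component 1111 expresses \<open>c\<close> through smooth functions and so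
    supplies its smoothness.\<close>
  have c: "c y = R 1 1 1 1 y * (1/2) * inverse (g 1 1 y) * inverse (g 1 1 y)" if "y \<in> U" for y
    using R[OF that, of 1 1 1 1] g11_nonzero[OF that] by (simp add: field_simps)
  have "smooth_on (\<lambda>y. R 1 1 1 1 y * (1/2) * inverse (g 1 1 y) * inverse (g 1 1 y)) U"
    using g11_nonzero by (intro smooth_on_mult smooth_on_inverse) simp_all
  then have sm [simp]: "smooth_on c U"
    by (rule smooth_on_cong[rotated 2]) (simp_all add: c)
  have real: "cnj (c y) = c y" if "y \<in> U" for y
    using that by (simp only: c[OF that]) (simp add: R_1111_real herm)
  then show "cnj (c z) = c z" using z .
  have D: "pz l (R j m k h) z = pz l c z * (g j m z * g k h z + g j h z * g k m z) +
      c z * (A l j m z * g k h z + g j m z * A l k h z + A l j h z * g k m z + g j h z * A l k m z)" for l j m k h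
  proof -
    have "pz l (R j m k h) z = pz l (\<lambda>y. c y * (g j m y * g k h y + g j h y * g k m y)) z"
      by (rule congU[OF z]) (simp add: R)
    then show ?thesis using z
      by (simp add: wop_mult wop_add diffU A_def algebra_simps)
  qed
  have G: "(\<Sum>r\<in>UNIV. Gam r j k z * R r m l h z) = c z * (A k j m z * g l h z + A k j h z * g l m z)" for j k m l h
  proof -
    have "(\<Sum>r\<in>UNIV. Gam r j k z * R r m l h z) =
      c z * ((\<Sum>r\<in>UNIV. Gam r j k z * g r m z) * g l h z + (\<Sum>r\<in>UNIV. Gam r j k z * g r h z) * g l m z)"
      by (simp add: R z sum_2 algebra_simps)
    then show ?thesis by (simp add: lower_Gam z)
  qed
  have *: "pz l c z * (g j m z * g k h z + g j h z * g k m z) = pz j c z * (g l m z * g k h z + g l h z * g k m z)" for l j m k h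
    using bianchi[OF z, of l j m k h] A_sym[OF z, of l j] A_sym[OF z, of k j] A_sym[OF z, of k l]
    by (simp add: D G algebra_simps)
  \<comment> \<open>Setting \<open>h = m\<close> merges the two terms of the model, and every column
    of \<open>g\<close> has a nonzero entry to cancel.\<close>
  have "pz 1 c z * g 2 m z = pz 2 c z * g 1 m z" for m
  proof -
    have 1: "(pz 1 c z * g 2 m z - pz 2 c z * g 1 m z) * g k m z = 0" for k
      using *[of 1 2 m k m] by (simp add: algebra_simps)
    have "g 1 m z \<noteq> 0 \<or> g 2 m z \<noteq> 0"
      using gdet_nonzero[OF z] exhaust_2[of m] by (auto simp: gdet_def)
    with 1[of 1] 1[of 2] show ?thesis by auto
  qed
  then have 12: "pz 1 c z * g 2 m z = pz 2 c z * g 1 m z" for m .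
  have "pz 1 c z * gdet z = 0" "pz 2 c z * gdet z = 0"
    using 12[of 1] 12[of 2] unfolding gdet_def by algebra+
  then have 0: "pz k c z = 0" for k
    using gdet_nonzero[OF z] exhaust_2[of k] by auto
  have "pzb k c z = 0" for k
  proof -
    have "pzb k c z = pzb k (\<lambda>y. cnj (c y)) z" by (rule congU[OF z]) (simp add: real)
    also have "\<dots> = 0" using 0[of k] z by (simp add: wop_cnj diffU)
    finally show ?thesis .
  qed
  with 0 have "frechet_derivative c (at z) = (\<lambda>v. 0)"
    using z by (simp add: fun_eq_iff frechet_derivative_wirtinger diffU)
  then show "(c has_derivative (\<lambda>v. 0)) (at z)"
    using smooth_on_has_derivative[OF sm z] by simp
qed

end

section \<open>Metrics along holomorphic curves\<close>

text \<open>\<open>a\<close> and \<open>b\<close> are the two Wirtinger derivatives of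
  \<open>f\<close> at \<open>t\<close>. The relational form lets resolution compute both from
  unknowns.\<close>

definition has_wirt :: "(complex \<Rightarrow> complex) \<Rightarrow> complex \<Rightarrow> complex \<Rightarrow> complex \<Rightarrow> bool" where
  "has_wirt f a b t \<longleftrightarrow> (f has_derivative (\<lambda>w. a * w + b * cnj w)) (at t)"

lemma has_wirt_unique:
  assumes "has_wirt f a b t" "has_wirt f a' b' t"
  shows "a = a' \<and> b = b'"
proof -
  have "(\<lambda>w. a * w + b * cnj w) = (\<lambda>w. a' * w + b' * cnj w)"
    using assms has_derivative_unique unfolding has_wirt_def by blast
  from fun_cong[OF this, of 1] fun_cong[OF this, of \<i>] show ?thesis
    by (simp add: complex_eq_iff)
qed

lemma has_wirt_cong:
  "open D \<Longrightarrow> t \<in> D \<Longrightarrow> (\<And>t. t \<in> D \<Longrightarrow> f t = f' t) \<Longrightarrow> has_wirt f a b t \<Longrightarrow> has_wirt f' a b t"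
  unfolding has_wirt_def using has_derivative_transform_within_open by blast

lemma has_wirt_mult:
  assumes "has_wirt f a b t" "has_wirt f' a' b' t"
  shows "has_wirt (\<lambda>t. f t * f' t) (a * f' t + f t * a') (b * f' t + f t * b') t"
  using has_derivative_mult[OF assms[unfolded has_wirt_def]]
  unfolding has_wirt_def by (rule has_derivative_eq_rhs) (simp add: algebra_simps)

lemma has_wirt_add:
  assumes "has_wirt f a b t" "has_wirt f' a' b' t"
  shows "has_wirt (\<lambda>t. f t + f' t) (a + a') (b + b') t"
  using has_derivative_add[OF assms[unfolded has_wirt_def]]
  unfolding has_wirt_def by (rule has_derivative_eq_rhs) (simp add: algebra_simps)

lemma has_wirt_sum:
  assumes "\<And>i. i \<in> I \<Longrightarrow> has_wirt (f i) (a i) (b i) t"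
  shows "has_wirt (\<lambda>t. \<Sum>i\<in>I. f i t) (\<Sum>i\<in>I. a i) (\<Sum>i\<in>I. b i) t"
  using assms
proof (induction I rule: infinite_finite_induct)
  case (insert x F)
  then show ?case by (simp add: has_wirt_add)
qed (simp_all add: has_wirt_def)

lemma has_wirt_holomorphic: "(f has_field_derivative a) (at t) \<Longrightarrow> has_wirt f a 0 t"
  by (simp add: has_wirt_def has_field_derivative_def)

lemma has_wirt_cnj: "(f has_field_derivative a) (at t) \<Longrightarrow> has_wirt (\<lambda>t. cnj (f t)) 0 (cnj a) t"
  using has_derivative_cnj[of f "(*) a" "at t"] by (simp add: has_wirt_def has_field_derivative_def)

lemma has_derivative_curve:
  fixes \<sigma> :: "complex \<Rightarrow> complex^'n::finite"
  assumes "\<And>i. ((\<lambda>t. \<sigma> t $ i) has_field_derivative v $ i) (at t)"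
  shows "(\<sigma> has_derivative (\<lambda>w. w *s v)) (at t)"
proof -
  have "(\<sigma> has_derivative (\<lambda>w. \<chi> i. v $ i * w)) (at t)"
    using assms by (subst has_derivative_componentwise_within)
      (auto simp: Basis_vec_def inner_axis has_field_derivative_def intro!: bounded_linear.has_derivative[OF bounded_linear_inner_left])
  then show ?thesis by (rule has_derivative_eq_rhs) (simp add: fun_eq_iff vec_eq_iff)
qed

lemma has_wirt_compose:
  fixes \<sigma> :: "complex \<Rightarrow> complex^'n::finite"
  assumes "f differentiable (at (\<sigma> t))"
    and "\<And>i. ((\<lambda>t. \<sigma> t $ i) has_field_derivative v $ i) (at t)"
  shows "has_wirt (\<lambda>t. f (\<sigma> t)) (\<Sum>k\<in>UNIV. pz k f (\<sigma> t) * v $ k) (\<Sum>k\<in>UNIV. pzb k f (\<sigma> t) * cnj (v $ k)) t"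
proof -
  from has_derivative_compose[OF has_derivative_curve[OF assms(2)] assms(1)[unfolded frechet_derivative_works]] show ?thesis
    unfolding has_wirt_def frechet_derivative_wirtinger[OF assms(1)]
    by (rule has_derivative_eq_rhs) (simp add: fun_eq_iff sum.distrib sum_distrib_right sum_distrib_left mult_ac)
qed

context hermitian_chart
begin

definition R4 :: "complex^2 \<Rightarrow> complex^2 \<Rightarrow> complex" where
  "R4 z v = (\<Sum>j\<in>UNIV. \<Sum>m\<in>UNIV. \<Sum>k\<in>UNIV. \<Sum>h\<in>UNIV. R j m k h z * v $ j * cnj (v $ m) * v $ k * cnj (v $ h))"

definition H :: "complex^2 \<Rightarrow> complex^2 \<Rightarrow> complex" where
  "H z v = (\<Sum>i\<in>UNIV. \<Sum>j\<in>UNIV. g i j z * v $ i * cnj (v $ j))"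

definition acc :: "complex^2 \<Rightarrow> complex^2 \<Rightarrow> complex^2 \<Rightarrow> complex^2" where
  "acc z v a = (\<chi> i. a $ i + (\<Sum>j\<in>UNIV. \<Sum>k\<in>UNIV. Gam i j k z * v $ j * v $ k))"

text \<open>The Gauss equation for a holomorphic curve.\<close>

lemma curve_mixed_derivative:
  fixes \<sigma> v a :: "complex \<Rightarrow> complex^2"
  assumes D: "open D" "t\<^sub>0 \<in> D" and U: "\<And>t. t \<in> D \<Longrightarrow> \<sigma> t \<in> U"
    and v: "\<And>t i. t \<in> D \<Longrightarrow> ((\<lambda>t. \<sigma> t $ i) has_field_derivative v t $ i) (at t)"
    and a: "\<And>t i. t \<in> D \<Longrightarrow> ((\<lambda>t. v t $ i) has_field_derivative a t $ i) (at t)"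
    and a': "\<And>i. (\<lambda>t. a t $ i) field_differentiable (at t\<^sub>0)"
  obtains P Q c where "\<And>t. t \<in> D \<Longrightarrow> has_wirt (\<lambda>t. H (\<sigma> t) (v t)) (P t) (Q t) t"
    "has_wirt P c (H (\<sigma> t\<^sub>0) (acc (\<sigma> t\<^sub>0) (v t\<^sub>0) (a t\<^sub>0)) - R4 (\<sigma> t\<^sub>0) (v t\<^sub>0)) t\<^sub>0"
proof -
  obtain a2 where a2: "((\<lambda>t. a t $ i) has_field_derivative a2 i) (at t\<^sub>0)" for i
    using a' unfolding field_differentiable_def by metis
  have comp: "has_wirt (\<lambda>t. f (\<sigma> t)) (\<Sum>k\<in>UNIV. pz k f (\<sigma> t) * v t $ k) (\<Sum>k\<in>UNIV. pzb k f (\<sigma> t) * cnj (v t $ k)) t"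
    if "smooth_on f U" "t \<in> D" for f t
    by (rule has_wirt_compose[OF diffU[OF that(1) U[OF that(2)]] v[OF that(2)]])
  note W = has_wirt_sum has_wirt_add has_wirt_mult comp has_wirt_holomorphic[OF v] has_wirt_holomorphic[OF a]
    has_wirt_cnj[OF v] has_wirt_cnj[OF a] has_wirt_holomorphic[OF a2]
  \<comment> \<open>The holomorphic derivative of the squared speed: the conjugated velocity is
    antiholomorphic, so only \<open>g\<close> and the first \<open>v\<close> are
    differentiated.\<close>
  define P where "P t = (\<Sum>i\<in>UNIV. \<Sum>j\<in>UNIV. ((\<Sum>k\<in>UNIV. A k i j (\<sigma> t) * v t $ k) * v t $ i +
     g i j (\<sigma> t) * a t $ i) * cnj (v t $ j))" for t
  have "\<exists>Q. has_wirt (\<lambda>t. H (\<sigma> t) (v t)) (P t) Q t" if "t \<in> D" for t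
  proof -
    \<comment> \<open>The equation \<open>p = P t\<close> is split off so that resolution may first
      produce the coefficient in its own form.\<close>
    have "\<exists>p Q. has_wirt (\<lambda>t. H (\<sigma> t) (v t)) p Q t \<and> p = P t"
      unfolding H_def
      by (intro exI conjI, (rule W smooth_g that)+) (simp add: P_def A_def)
    then show ?thesis by blast
  qed
  then obtain Q where Q: "\<And>t. t \<in> D \<Longrightarrow> has_wirt (\<lambda>t. H (\<sigma> t) (v t)) (P t) (Q t) t" by metis
  let ?z = "\<sigma> t\<^sub>0" and ?v = "v t\<^sub>0" and ?a = "a t\<^sub>0"
  note z = U[OF D(2)]
  \<comment> \<open>The antiholomorphic derivative of \<open>P\<close>. The derivative
    \<open>a2\<close> of the acceleration enters the holomorphic one only.\<close>
  define E where "E = (\<Sum>i\<in>UNIV. \<Sum>j\<in>UNIV. 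
     ((\<Sum>k\<in>UNIV. (\<Sum>h\<in>UNIV. pzb h (A k i j) ?z * cnj (?v $ h)) * ?v $ k) * ?v $ i +
       (\<Sum>h\<in>UNIV. pzb h (g i j) ?z * cnj (?v $ h)) * ?a $ i) * cnj (?v $ j) +
     ((\<Sum>k\<in>UNIV. A k i j ?z * ?v $ k) * ?v $ i + g i j ?z * ?a $ i) * cnj (?a $ j))"
  have "\<exists>p q. has_wirt P p q t\<^sub>0 \<and> q = E"
    unfolding P_def[abs_def]
    by (intro exI conjI, (rule W smooth_g smooth_A D)+) (simp add: E_def)
  then obtain p where p: "has_wirt P p E t\<^sub>0" by blast
  \<comment> \<open>The connection part \<open>Gam(v, v)\<close> of the covariant acceleration; from
    here on \<open>D\<close> hides the parameter domain.\<close>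
  define D where "D i = (\<Sum>j\<in>UNIV. \<Sum>k\<in>UNIV. Gam i j k ?z * ?v $ j * ?v $ k)" for i
  have 1: "(\<Sum>j\<in>UNIV. \<Sum>k\<in>UNIV. A k j m ?z * ?v $ j * ?v $ k) = (\<Sum>i\<in>UNIV. D i * g i m ?z)" for m
    unfolding lower_Gam[OF z, symmetric] D_def by (simp add: sum_2 algebra_simps)
  have 2: "(\<Sum>h\<in>UNIV. \<Sum>j\<in>UNIV. pzb h (g i j) ?z * cnj (?v $ h) * cnj (?v $ j)) = (\<Sum>m\<in>UNIV. cnj (D m) * g i m ?z)" for i
    using arg_cong[OF 1[of i], of cnj] z by (simp add: cnj_A herm) (simp add: sum_2 algebra_simps)
  have 3: "R4 ?z ?v = (\<Sum>r\<in>UNIV. cnj (D r) * (\<Sum>j\<in>UNIV. \<Sum>k\<in>UNIV. A k j r ?z * ?v $ j * ?v $ k)) -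
     (\<Sum>i\<in>UNIV. \<Sum>j\<in>UNIV. ((\<Sum>k\<in>UNIV. (\<Sum>h\<in>UNIV. pzb h (A k i j) ?z * cnj (?v $ h)) * ?v $ k) * ?v $ i) * cnj (?v $ j))"
    unfolding R4_def R_def D_def by (simp add: sum_2 algebra_simps)
  \<comment> \<open>Completing the square: the terms of \<open>E\<close> without second derivatives
    of \<open>g\<close>, together with the quadratic part of \<open>R4\<close>, form the squared
    norm of \<open>a + Gam(v, v)\<close>.\<close>
  have "E = H ?z (acc ?z ?v ?a) - R4 ?z ?v"
  proof -
    have "E = (\<Sum>i\<in>UNIV. \<Sum>j\<in>UNIV. ((\<Sum>k\<in>UNIV. (\<Sum>h\<in>UNIV. pzb h (A k i j) ?z * cnj (?v $ h)) * ?v $ k) * ?v $ i) * cnj (?v $ j)) +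
      (\<Sum>i\<in>UNIV. ?a $ i * (\<Sum>h\<in>UNIV. \<Sum>j\<in>UNIV. pzb h (g i j) ?z * cnj (?v $ h) * cnj (?v $ j))) +
      (\<Sum>m\<in>UNIV. cnj (?a $ m) * (\<Sum>j\<in>UNIV. \<Sum>k\<in>UNIV. A k j m ?z * ?v $ j * ?v $ k)) +
      (\<Sum>i\<in>UNIV. \<Sum>j\<in>UNIV. g i j ?z * ?a $ i * cnj (?a $ j))"
      unfolding E_def by (simp add: sum_2 algebra_simps)
    also have "\<dots> = H ?z (acc ?z ?v ?a) - R4 ?z ?v"
      unfolding 3 2 1 H_def acc_def D_def[symmetric] by (simp add: sum_2 algebra_simps)
    finally show ?thesis .
  qed
  with p Q that show ?thesis by blast
qed

end

text \<open>The test curve has vanishing covariant acceleration at \<open>z\<close> in the first chart. Only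
  one-variable holomorphy along the curve is used, so no higher smoothness of \<open>\<phi>\<close> is needed.\<close>

lemma R4_le_transition:
  assumes c: "hermitian_chart U g" and d: "hermitian_chart U' g'"
    and U0: "open U0" "U0 \<subseteq> U" and maps: "\<And>z. z \<in> U0 \<Longrightarrow> \<phi> z \<in> U'"
    and B: "\<And>z. z \<in> U0 \<Longrightarrow> (\<phi> has_derivative (\<lambda>v. B z *v v)) (at z)"
    and H: "\<And>z v. z \<in> U0 \<Longrightarrow> hermitian_chart.H g z v = hermitian_chart.H g' (\<phi> z) (B z *v v)"
    and z: "z \<in> U0"
  shows "Re (hermitian_chart.R4 g z v) \<le> Re (hermitian_chart.R4 g' (\<phi> z) (B z *v v))"
proof -
  interpret c: hermitian_chart U g by fact
  interpret d: hermitian_chart U' g' by fact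
  define a where "a = (\<chi> i. - (\<Sum>j\<in>UNIV. \<Sum>k\<in>UNIV. c.Gam i j k z * v $ j * v $ k))"
  define \<gamma> where "\<gamma> t = (\<chi> i. z $ i + t * v $ i + t\<^sup>2 * (a $ i / 2))" for t
  define \<gamma>' where "\<gamma>' t = (\<chi> i. v $ i + t * a $ i)" for t
  have D1: "((\<lambda>t. \<gamma> t $ i) has_field_derivative \<gamma>' t $ i) (at t)" for t i
    unfolding \<gamma>_def \<gamma>'_def by (auto intro!: derivative_eq_intros)
  have D2: "((\<lambda>t. \<gamma>' t $ i) has_field_derivative a $ i) (at t)" for t i
    unfolding \<gamma>'_def by (auto intro!: derivative_eq_intros)
  have \<gamma>: "(\<gamma> has_derivative (\<lambda>w. w *s \<gamma>' t)) (at t)" for t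
    by (rule has_derivative_curve[OF D1])
  define D where "D = \<gamma> -` U0"
  have "open D" unfolding D_def
    by (rule open_vimage[OF U0(1)])
      (metis \<gamma> continuous_at_imp_continuous_on has_derivative_continuous)
  have "\<gamma> 0 = z" "\<gamma>' 0 = v" by (simp_all add: \<gamma>_def \<gamma>'_def vec_eq_iff)
  then have "0 \<in> D" using z by (simp add: D_def)
  define w where "w t = B (\<gamma> t) *v \<gamma>' t" for t
  have E1: "((\<lambda>t. \<phi> (\<gamma> t) $ i) has_field_derivative w t $ i) (at t)" if "t \<in> D" for t i
  proof -
    have "((\<lambda>t. \<phi> (\<gamma> t)) has_derivative (\<lambda>r. B (\<gamma> t) *v (r *s \<gamma>' t))) (at t)"
      using has_derivative_compose[OF \<gamma> B] that by (simp add: D_def)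
    from bounded_linear.has_derivative[OF bounded_linear_vec_nth this] show ?thesis
      unfolding has_field_derivative_def
      by (rule has_derivative_eq_rhs)
        (simp add: fun_eq_iff w_def matrix_vector_mult_def sum_distrib_left mult_ac)
  qed
  \<comment> \<open>Complex differentiability on an open set of parameters already makes the image
    curve holomorphic, hence its velocity too; this stands in for second derivatives of
    \<open>\<phi>\<close>.\<close>
  have hol: "(\<lambda>t. w t $ i) holomorphic_on D" for i
  proof -
    have "(\<lambda>t. \<phi> (\<gamma> t) $ i) holomorphic_on D"
      using E1 \<open>open D\<close> by (auto simp: holomorphic_on_open)
    then have "deriv (\<lambda>t. \<phi> (\<gamma> t) $ i) holomorphic_on D"
      using \<open>open D\<close> by (rule holomorphic_deriv)
    then show ?thesis
      by (rule holomorphic_transform) (simp add: DERIV_imp_deriv E1)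
  qed
  define b where "b t = (\<chi> i. deriv (\<lambda>t. w t $ i) t)" for t
  have E2: "((\<lambda>t. w t $ i) has_field_derivative b t $ i) (at t)" if "t \<in> D" for t i
    using holomorphic_derivI[OF hol \<open>open D\<close> that] by (simp add: b_def)
  have E3: "(\<lambda>t. b t $ i) field_differentiable (at 0)" for i
    using holomorphic_on_imp_differentiable_at[OF holomorphic_deriv[OF hol \<open>open D\<close>] \<open>open D\<close> \<open>0 \<in> D\<close>]
    by (simp add: b_def)
  obtain P Q r where P: "\<And>t. t \<in> D \<Longrightarrow> has_wirt (\<lambda>t. c.H (\<gamma> t) (\<gamma>' t)) (P t) (Q t) t"
    "has_wirt P r (c.H (\<gamma> 0) (c.acc (\<gamma> 0) (\<gamma>' 0) a) - c.R4 (\<gamma> 0) (\<gamma>' 0)) 0"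
    by (rule c.curve_mixed_derivative[where \<sigma> = \<gamma> and v = \<gamma>' and a = "\<lambda>t. a", OF \<open>open D\<close> \<open>0 \<in> D\<close> _ D1 D2])
      (use U0 in \<open>auto simp: D_def\<close>)
  obtain P' Q' r' where P': "\<And>t. t \<in> D \<Longrightarrow> has_wirt (\<lambda>t. d.H (\<phi> (\<gamma> t)) (w t)) (P' t) (Q' t) t"
    "has_wirt P' r' (d.H (\<phi> (\<gamma> 0)) (d.acc (\<phi> (\<gamma> 0)) (w 0) (b 0)) - d.R4 (\<phi> (\<gamma> 0)) (w 0)) 0"
    by (rule d.curve_mixed_derivative[where \<sigma> = "\<lambda>t. \<phi> (\<gamma> t)", OF \<open>open D\<close> \<open>0 \<in> D\<close> _ E1 E2 E3])
      (use maps in \<open>auto simp: D_def\<close>)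
  \<comment> \<open>\<open>P\<close> is differentiated once more, so equality is needed on a
    neighbourhood of 0.\<close>
  have "P t = P' t" if t: "t \<in> D" for t
  proof -
    have "has_wirt (\<lambda>t. d.H (\<phi> (\<gamma> t)) (w t)) (P t) (Q t) t"
      by (rule has_wirt_cong[OF \<open>open D\<close> t _ P(1)[OF t]]) (simp add: H w_def D_def)
    from has_wirt_unique[OF this P'(1)[OF t]] show ?thesis by simp
  qed
  then have "has_wirt P' r (c.H (\<gamma> 0) (c.acc (\<gamma> 0) (\<gamma>' 0) a) - c.R4 (\<gamma> 0) (\<gamma>' 0)) 0"
    using has_wirt_cong[OF \<open>open D\<close> \<open>0 \<in> D\<close> _ P(2)] by blast
  from has_wirt_unique[OF this P'(2)]
  have "c.H z (c.acc z v a) - c.R4 z v = d.H (\<phi> z) (d.acc (\<phi> z) (w 0) (b 0)) - d.R4 (\<phi> z) (w 0)"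
    by (simp add: \<open>\<gamma> 0 = z\<close> \<open>\<gamma>' 0 = v\<close>)
  \<comment> \<open>The acceleration term is zero in the first chart and nonnegative in the second,
    which turns the equality of mixed derivatives into an inequality of curvatures.\<close>
  moreover have "c.acc z v a = 0" by (simp add: c.acc_def a_def vec_eq_iff)
  then have "c.H z (c.acc z v a) = 0" by (simp add: c.H_def)
  moreover have "0 \<le> Re (d.H (\<phi> z) y)" for y
    using d.pos[OF maps[OF z], of y] unfolding d.H_def by (cases "y = 0") (auto intro: less_imp_le)
  ultimately have "Re (c.R4 z v) \<le> Re (d.R4 (\<phi> z) (w 0))"
    by (smt (verit) minus_complex.simps(1) zero_complex.simps(1))
  then show ?thesis by (simp add: w_def \<open>\<gamma> 0 = z\<close> \<open>\<gamma>' 0 = v\<close>)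
qed

section \<open>The slit tangent bundle over a chart\<close>

lemma d_ops:
  "d_z k = wop (- \<i>) (axis k 1, 0) (axis k \<i>, 0)" "d_zbar k = wop \<i> (axis k 1, 0) (axis k \<i>, 0)"
  "d_eta k = wop (- \<i>) (0, axis k 1) (0, axis k \<i>)" "d_etabar k = wop \<i> (0, axis k 1) (0, axis k \<i>)"
  by (simp_all add: fun_eq_iff d_z_def d_zbar_def d_eta_def d_etabar_def wop_def)

lemma deltabar_cong:
  "open S \<Longrightarrow> x \<in> S \<Longrightarrow> (\<And>y. y \<in> S \<Longrightarrow> f y = f' y) \<Longrightarrow> deltabar F h f x = deltabar F h f' x"
  using wop_cong[of S x f f'] unfolding deltabar_def d_ops by simp

lemma deltabar_mult:
  assumes "f differentiable (at x)" "f' differentiable (at x)"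
  shows "deltabar F h (\<lambda>x. f x * f' x) x = deltabar F h f x * f' x + f x * deltabar F h f' x"
  by (simp add: deltabar_def d_ops wop_mult assms algebra_simps sum.distrib sum_distrib_left)

lemma wop_fst:
  assumes "f differentiable (at (fst x))"
  shows "wop s u v (\<lambda>x. f (fst x)) x = wop s (fst u) (fst v) f (fst x)"
  by (subst wop_at[OF has_derivative_compose[OF has_derivative_fst[OF has_derivative_ident]
        assms[unfolded frechet_derivative_works]]]) (simp add: wop_def)

lemma wop_zero [simp]: "wop s 0 0 f x = 0" if "f differentiable (at x)"
  using linear_0[OF linear_frechet_derivative[OF that]] by (simp add: wop_def)

lemma wop_snd: "wop s u v (\<lambda>x. snd x $ j) x = (snd u $ j + s * snd v $ j) / 2"
  by (rule wop_at) (intro bounded_linear.has_derivative[OF bounded_linear_vec_nth] has_derivative_snd has_derivative_ident)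

lemma wop_cnj_snd: "wop s u v (\<lambda>x. cnj (snd x $ j)) x = (cnj (snd u $ j) + s * cnj (snd v $ j)) / 2"
  by (rule wop_at) (intro has_derivative_cnj bounded_linear.has_derivative[OF bounded_linear_vec_nth] has_derivative_snd has_derivative_ident)

lemma smooth_on_snd [simp]: "open S \<Longrightarrow> smooth_on (\<lambda>x. snd x $ j) S"
  unfolding smooth_on_def
  by (intro allI Ck_on_bounded_linear_id bounded_linear_compose[OF bounded_linear_vec_nth bounded_linear_snd])

lemma matrix_inv_eqI:
  fixes A B :: "complex^'n^'n"
  assumes "A ** B = mat 1"
  shows "matrix_inv A = B"
proof -
  have "A ** matrix_inv A = mat 1 \<and> matrix_inv A ** A = mat 1"
    unfolding matrix_inv_def
    by (rule someI[of "\<lambda>A'. A ** A' = mat 1 \<and> A' ** A = mat 1" B])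
      (simp add: assms iffD1[OF matrix_left_right_inverse assms])
  then have "matrix_inv A ** (A ** B) = B"
    by (simp add: matrix_mul_assoc)
  then show ?thesis using assms by simp
qed

definition slit :: "(complex^2) set \<Rightarrow> ((complex^2) \<times> (complex^2)) set" where
  "slit U = U \<times> (UNIV - {0})"

lemma mem_slit: "(z, v) \<in> slit U \<longleftrightarrow> z \<in> U \<and> v \<noteq> 0"
  by (simp add: slit_def)

lemma slitD: "x \<in> slit U \<Longrightarrow> fst x \<in> U" "x \<in> slit U \<Longrightarrow> snd x \<noteq> 0"
  by (auto simp: slit_def)

text \<open>The situation of the theorem seen from one chart. Homogeneity is stated for
  \<open>a \<noteq> 0\<close>, where the scaled point stays off the zero section.\<close>

locale finsler_chart =
  fixes U :: "(complex^2) set" and F :: "(complex^2) \<times> (complex^2) \<Rightarrow> real"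
  assumes open_U: "open U"
    and smooth_F2: "smooth_on (\<lambda>x. (F x)\<^sup>2) (slit U)"
    and F_nonneg: "x \<in> slit U \<Longrightarrow> 0 \<le> F x"
    and F_homogeneous: "(z, \<eta>) \<in> slit U \<Longrightarrow> a \<noteq> 0 \<Longrightarrow> F (z, a *s \<eta>) = cmod a * F (z, \<eta>)"
    and pos_def: "x \<in> slit U \<Longrightarrow> hermitian_pos_def (gmat F x)"
    and torsion_free: "x \<in> slit U \<Longrightarrow> (\<Sum>j\<in>UNIV. torsion F i j k x * snd x $ j) = 0"
    and pure: "(z, \<eta>) \<in> slit U \<Longrightarrow> (z, \<eta>') \<in> slit U \<Longrightarrow>
      gmat F (z, \<eta>) = gmat F (z, \<eta>')"
begin

abbreviation S :: "((complex^2) \<times> (complex^2)) set" where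
  "S \<equiv> slit U"

definition L :: "(complex^2) \<times> (complex^2) \<Rightarrow> complex" where
  "L x = complex_of_real ((F x)\<^sup>2)"

text \<open>The fibre vector is an arbitrary nonzero choice; by \<open>pure\<close> every other one
  gives the same matrix.\<close>

definition g :: "2 \<Rightarrow> 2 \<Rightarrow> complex^2 \<Rightarrow> complex" where
  "g i j z = gmat F (z, axis 1 1) $ i $ j"

lemma open_S [simp]: "open S"
  unfolding slit_def by (intro open_Times open_U open_Diff) auto

lemma diffS: "smooth_on f S \<Longrightarrow> x \<in> S \<Longrightarrow> f differentiable (at x)"
  by (rule smooth_on_differentiable)

lemma congS: "x \<in> S \<Longrightarrow> (\<And>y. y \<in> S \<Longrightarrow> f y = f' y) \<Longrightarrow> wop s u v f x = wop s u v f' x"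
  by (rule wop_cong[OF open_S])

lemma smooth_L [simp]: "smooth_on L S"
  unfolding L_def[abs_def] by (rule smooth_on_bounded_linear[OF open_S bounded_linear_of_real smooth_F2])

lemma gmat_eq: "x \<in> S \<Longrightarrow> gmat F x $ i $ j = g i j (fst x)"
  unfolding g_def using pure[of "fst x" "snd x" "axis 1 1"] by (auto simp: slit_def axis_eq_0_iff)

lemma gmat_L: "gmat F x $ i $ j = d_eta i (d_etabar j L) x"
  by (simp add: gmat_def L_def[abs_def])

lemma smooth_g: "smooth_on (g i j) U"
proof -
  have "smooth_on (\<lambda>z. d_eta i (d_etabar j L) (z, axis 1 1)) U"
    by (rule smooth_on_slice[where S = S]) (simp_all add: open_U d_ops mem_slit axis_eq_0_iff)
  then show ?thesis by (simp add: g_def[abs_def] gmat_L)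
qed

sublocale hermitian_chart U g
proof
  show "open U" by (rule open_U)
  show "smooth_on (g i j) U" for i j by (rule smooth_g)
  fix z :: "complex^2" assume z: "z \<in> U"
  then have "hermitian_pos_def (gmat F (z, axis 1 1))"
    by (intro pos_def) (simp add: mem_slit axis_eq_0_iff)
  note p = this[unfolded hermitian_pos_def_def]
  show "cnj (g i j z) = g j i z" for i j
    using conjunct1[OF p] unfolding g_def by metis
  show "0 < Re (\<Sum>i\<in>UNIV. \<Sum>j\<in>UNIV. g i j z * v $ i * cnj (v $ j))" if "v \<noteq> 0" for v
    using conjunct2[OF p] that unfolding g_def by blast
qed

lemma smooth_fst [simp]:
  fixes f :: "complex^2 \<Rightarrow> complex"
  shows "smooth_on f U \<Longrightarrow> smooth_on (\<lambda>x. f (fst x)) S"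
proof -
  assume f: "smooth_on f U"
  have "Ck_on k (\<lambda>x. f (fst x)) S" if "Ck_on k f U" for k and f :: "complex^2 \<Rightarrow> complex"
    using that
  proof (induction k arbitrary: f)
    case 0
    then show ?case by (auto intro!: continuous_on_compose2[of U f] continuous_intros dest: slitD)
  next
    case (Suc k)
    show ?case
    proof (rule Ck_on_SucI[where f' = "\<lambda>x v. frechet_derivative f (at (fst x)) (fst v)", OF open_S])
      fix x assume "x \<in> S"
      then have "(f has_derivative frechet_derivative f (at (fst x))) (at (fst x))"
        using Suc.prems Ck_on_has_derivative slitD(1) by blast
      from has_derivative_compose[OF has_derivative_fst[OF has_derivative_ident] this]
      show "((\<lambda>x. f (fst x)) has_derivative (\<lambda>v. frechet_derivative f (at (fst x)) (fst v))) (at x)" .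
    next
      show "Ck_on k (\<lambda>x. frechet_derivative f (at (fst x)) (fst v)) S" for v :: "(complex^2) \<times> (complex^2)"
        by (rule Suc.IH[of "\<lambda>z. frechet_derivative f (at z) (fst v)"]) (use Suc.prems in simp)
    qed
  qed
  with f show ?thesis by (simp add: smooth_on_def)
qed

lemma base_derivatives:
  assumes "x \<in> S" "smooth_on f U"
  shows "d_z k (\<lambda>x. f (fst x)) x = pz k f (fst x)" "d_zbar k (\<lambda>x. f (fst x)) x = pzb k f (fst x)"
    "d_eta k (\<lambda>x. f (fst x)) x = 0" "d_etabar k (\<lambda>x. f (fst x)) x = 0"
proof -
  have "f differentiable (at (fst x))" using diffU[OF assms(2)] assms(1) slitD(1) by blast
  then show "d_z k (\<lambda>x. f (fst x)) x = pz k f (fst x)" "d_zbar k (\<lambda>x. f (fst x)) x = pzb k f (fst x)"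
    "d_eta k (\<lambda>x. f (fst x)) x = 0" "d_etabar k (\<lambda>x. f (fst x)) x = 0"
    by (simp_all add: d_ops wop_fst)
qed

lemma fibre_derivatives:
  "d_zbar k (\<lambda>x. snd x $ j) x = 0" "d_zbar k (\<lambda>x. cnj (snd x $ j)) x = 0"
  "d_eta k (\<lambda>x. snd x $ j) x = (if k = j then 1 else 0)" "d_eta k (\<lambda>x. cnj (snd x $ j)) x = 0"
  "d_etabar k (\<lambda>x. snd x $ j) x = 0" "d_etabar k (\<lambda>x. cnj (snd x $ j)) x = (if k = j then 1 else 0)"
  by (auto simp: d_ops wop_snd wop_cnj_snd axis_def)

lemma ginv_eq: "x \<in> S \<Longrightarrow> ginv F x $ m $ i = gi m i (fst x)"
proof -
  assume x: "x \<in> S"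
  then have z: "fst x \<in> U" by (rule slitD)
  have "gmat F x ** (\<chi> m i. gi m i (fst x)) = mat 1"
    using g_gi[OF z] by (simp add: matrix_matrix_mult_def mat_def vec_eq_iff gmat_eq[OF x])
  then have "ginv F x = (\<chi> m i. gi m i (fst x))"
    unfolding ginv_def by (rule matrix_inv_eqI)
  then show ?thesis by simp
qed

lemma d_gmat: assumes "x \<in> S"
  shows "d_z k (\<lambda>y. gmat F y $ j $ l) x = A k j l (fst x)" "d_eta k (\<lambda>y. gmat F y $ j $ l) x = 0"
proof -
  have "wop s u v (\<lambda>y. gmat F y $ j $ l) x = wop s u v (\<lambda>y. g j l (fst y)) x" for s u v
    by (rule congS[OF assms]) (rule gmat_eq)
  then show "d_z k (\<lambda>y. gmat F y $ j $ l) x = A k j l (fst x)" "d_eta k (\<lambda>y. gmat F y $ j $ l) x = 0"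
    using base_derivatives[OF assms smooth_g, of k j l] by (simp_all add: d_ops A_def)
qed

lemma nonlin_conn_eq: "x \<in> S \<Longrightarrow> nonlin_conn F k j x = (\<Sum>l\<in>UNIV. Gam k l j (fst x) * snd x $ l)"
  by (simp add: nonlin_conn_def d_gmat ginv_eq Gam_def sum_2 algebra_simps)

lemma hconn_eq: "x \<in> S \<Longrightarrow> hconn F i j k x = Gam i j k (fst x)"
  by (simp add: hconn_def delta_def d_gmat ginv_eq Gam_def)

sublocale kaehler_chart U g
proof
  fix z k j m assume z: "z \<in> U"
  have T: "Gam i j k z = Gam i k j z" for i j k
  proof -
    \<comment> \<open>The connection coefficients depend on the base point alone, so contracting the
      torsion with a coordinate vector isolates one component.\<close>
    have x: "(z, axis j 1) \<in> S" using z by (simp add: mem_slit axis_eq_0_iff)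
    have "(\<Sum>l\<in>UNIV. (Gam i l k z - Gam i k l z) * axis j 1 $ l) = 0"
      using torsion_free[OF x, of i k] by (simp add: torsion_def hconn_eq[OF x])
    then show ?thesis
      using exhaust_2[of j] by (auto simp: sum_2 axis_def)
  qed
  have "A k j m z = A j k m z"
    unfolding lower_Gam[OF z, symmetric] by (simp add: T[of _ j k])
  then show "pz k (g j m) z = pz j (g k m) z" by (simp add: A_def)
qed

section \<open>Euler's relations and the metric as a quadratic form\<close>

lemma euler_L:
  assumes x: "x \<in> S"
  shows "(\<Sum>j\<in>UNIV. cnj (snd x $ j) * d_etabar j L x) = L x"
    and "(\<Sum>j\<in>UNIV. snd x $ j * d_eta j L x) = L x"
proof -
  obtain z \<eta> where x_eq: "x = (z, \<eta>)" and z: "z \<in> U" and \<eta>: "\<eta> \<noteq> 0"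
    using x by (auto simp: slit_def)
  let ?D = "frechet_derivative L (at x)"
  have D: "(L has_derivative ?D) (at x)" by (rule smooth_on_has_derivative[OF smooth_L x])
  then have lin: "linear ?D" by (rule has_derivative_linear)
  \<comment> \<open>Differentiate \<open>L (z, (1 + r c) \<eta>) = |1 + r c|^2 L (z, \<eta>)\<close>
    at the real parameter \<open>r = 0\<close>. The cases \<open>c = 1\<close> and
    \<open>c = \<i>\<close> combine to both Wirtinger relations.\<close>
  have rad: "?D (0, c *s \<eta>) = 2 * Re c * L x" for c
  proof -
    have 1: "((\<lambda>r::real. (z, \<eta> + r *\<^sub>R (c *s \<eta>))) has_derivative (\<lambda>r. (0, r *\<^sub>R (c *s \<eta>)))) (at 0)"
      by (auto intro!: derivative_eq_intros)
    have D0: "(L has_derivative ?D) (at ((\<lambda>r::real. (z, \<eta> + r *\<^sub>R (c *s \<eta>))) 0))" using D by (simp add: x_eq)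
    have 2: "((\<lambda>r::real. L (z, \<eta> + r *\<^sub>R (c *s \<eta>))) has_derivative (\<lambda>r. ?D (0, r *\<^sub>R (c *s \<eta>)))) (at 0)"
      by (rule has_derivative_compose[OF 1 D0])
    \<comment> \<open>Excluding zeros of \<open>1 + r c\<close> keeps the scaled vector
      nonzero.\<close>
    have "open {r::real. 1 + of_real r * c \<noteq> 0}"
      by (intro open_Collect_neq continuous_intros)
    moreover have "L (z, \<eta> + r *\<^sub>R (c *s \<eta>)) = of_real ((1 + r * Re c)\<^sup>2 + (r * Im c)\<^sup>2) * L x"
      if "1 + of_real r * c \<noteq> 0" for r :: real
    proof -
      have "\<eta> + r *\<^sub>R (c *s \<eta>) = (1 + of_real r * c) *s \<eta>"
        by (simp add: vec_eq_iff algebra_simps) (simp add: scaleR_conv_of_real)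
      then have "F (z, \<eta> + r *\<^sub>R (c *s \<eta>)) = cmod (1 + of_real r * c) * F (z, \<eta>)"
        using F_homogeneous[of z \<eta> "1 + of_real r * c"] z \<eta> that by (simp add: mem_slit)
      moreover have "(cmod (1 + of_real r * c))\<^sup>2 = (1 + r * Re c)\<^sup>2 + (r * Im c)\<^sup>2"
        by (simp add: cmod_power2)
      ultimately show ?thesis
        by (simp only: L_def x_eq power_mult_distrib of_real_mult)
    qed
    ultimately have "((\<lambda>r::real. complex_of_real ((1 + r * Re c)\<^sup>2 + (r * Im c)\<^sup>2) * L x) has_derivative
       (\<lambda>r. ?D (0, r *\<^sub>R (c *s \<eta>)))) (at 0)"
      by (intro has_derivative_transform_within_open[OF 2]) auto
    moreover have "((\<lambda>r::real. complex_of_real ((1 + r * Re c)\<^sup>2 + (r * Im c)\<^sup>2) * L x) has_derivative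
       (\<lambda>r. of_real (2 * r * Re c) * L x)) (at 0)"
      by (auto intro!: derivative_eq_intros)
    ultimately have "(\<lambda>r. ?D (0, r *\<^sub>R (c *s \<eta>))) = (\<lambda>r. of_real (2 * r * Re c) * L x)"
      by (rule has_derivative_unique)
    from fun_cong[OF this, of 1] show ?thesis by simp
  qed
  have comp: "?D (0, w) = (\<Sum>k\<in>UNIV. Re (w $ k) *\<^sub>R ?D (0, axis k 1) + Im (w $ k) *\<^sub>R ?D (0, axis k \<i>))" for w
  proof -
    have l: "linear (\<lambda>w. ?D (0, w))"
      using linear_add[OF lin, of "(0, _)" "(0, _)"] linear_cmul[OF lin, of _ "(0, _)"]
      by (intro linearI) simp_all
    show ?thesis
      by (subst vec_complex_basis[of w]) (simp add: linear_sum[OF l] linear_add[OF l] linear_cmul[OF l])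
  qed
  have 1: "?D (0, \<eta>) = 2 * L x" and i: "?D (0, \<i> *s \<eta>) = 0" using rad[of 1] rad[of \<i>] by simp_all
  have "(\<Sum>j\<in>UNIV. cnj (snd x $ j) * d_etabar j L x) = (?D (0, \<eta>) + \<i> * ?D (0, \<i> *s \<eta>)) / 2"
    unfolding comp[of \<eta>] comp[of "\<i> *s \<eta>"]
    by (simp add: x_eq[symmetric] sum_2 d_etabar_def) (simp add: x_eq complex_eq_iff field_simps)
  then show "(\<Sum>j\<in>UNIV. cnj (snd x $ j) * d_etabar j L x) = L x" by (simp add: 1 i)
  have "(\<Sum>j\<in>UNIV. snd x $ j * d_eta j L x) = (?D (0, \<eta>) - \<i> * ?D (0, \<i> *s \<eta>)) / 2"
    unfolding comp[of \<eta>] comp[of "\<i> *s \<eta>"]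
    by (simp add: x_eq[symmetric] sum_2 d_eta_def) (simp add: x_eq complex_eq_iff field_simps)
  then show "(\<Sum>j\<in>UNIV. snd x $ j * d_eta j L x) = L x" by (simp add: 1 i)
qed

text \<open>\<open>d_eta i\<close> kills the conjugate coordinates, so the first Euler relation
  expresses \<open>d_eta i L\<close> through \<open>g\<close>; the second relation then recovers
  \<open>L\<close>.\<close>

lemma L_eq: assumes x: "x \<in> S" shows "L x = H (fst x) (snd x)"
proof -
  have 1: "d_eta i L x = (\<Sum>j\<in>UNIV. cnj (snd x $ j) * g i j (fst x))" for i
  proof -
    have "d_eta i L x = d_eta i (\<lambda>x. \<Sum>j\<in>UNIV. cnj (snd x $ j) * d_etabar j L x) x"
      unfolding d_ops by (rule congS[OF x]) (simp add: euler_L(1)[unfolded d_ops])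
    also have "\<dots> = (\<Sum>j\<in>UNIV. cnj (snd x $ j) * d_eta i (d_etabar j L) x)"
      using x fibre_derivatives(4)[of i _ x] by (simp add: d_ops wop_sum wop_mult diffS)
    finally show ?thesis by (simp add: gmat_eq[OF x, symmetric] gmat_L)
  qed
  show ?thesis
    using euler_L(2)[OF x] by (simp add: 1 H_def sum_2 algebra_simps)
qed

lemma F_pos: assumes x: "x \<in> S" shows "F x > 0"
proof -
  have "0 < Re (L x)" using pos[OF slitD[OF x]] by (simp only: L_eq[OF x] H_def)
  then have "0 < (F x)\<^sup>2" by (simp add: L_def)
  then show ?thesis using F_nonneg[OF x] by (simp add: less_eq_real_def)
qed

section \<open>Horizontal derivatives of F and J\<close>

abbreviation Fc :: "(complex^2) \<times> (complex^2) \<Rightarrow> complex" where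
  "Fc \<equiv> \<lambda>x. complex_of_real (F x)"

lemma Fc_differentiable: assumes x: "x \<in> S" shows "Fc differentiable (at x)"
proof -
  obtain D where D: "((\<lambda>x. (F x)\<^sup>2) has_derivative D) (at x)"
    using smooth_on_has_derivative[OF smooth_F2 x] by blast
  have "((\<lambda>y. sqrt ((F y)\<^sup>2)) has_derivative (\<lambda>w. D w * (inverse (sqrt ((F x)\<^sup>2)) / 2))) (at x)"
    by (rule has_derivative_real_sqrt[OF _ D]) (use F_pos[OF x] in simp)
  then have "(F has_derivative (\<lambda>w. D w * (inverse (sqrt ((F x)\<^sup>2)) / 2))) (at x)"
    by (rule has_derivative_transform_within_open[OF _ open_S x]) (simp add: F_nonneg)
  from bounded_linear.has_derivative[OF bounded_linear_of_real this] show ?thesis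
    unfolding differentiable_def by blast
qed

text \<open>Metric compatibility: lowering the index of the conjugate connection reproduces the base
  derivative of \<open>g\<close>, and the two terms of \<open>deltabar\<close> cancel.\<close>

lemma deltabar_L: assumes x: "x \<in> S" shows "deltabar F h L x = 0"
proof -
  have z: "fst x \<in> U" using x by (rule slitD)
  have c: "wop s u v L x = wop s u v (\<lambda>x. \<Sum>i\<in>UNIV. \<Sum>j\<in>UNIV. g i j (fst x) * snd x $ i * cnj (snd x $ j)) x" for s u v
    by (rule congS[OF x]) (simp add: L_eq H_def)
  have 1: "d_zbar h L x = (\<Sum>i\<in>UNIV. \<Sum>j\<in>UNIV. pzb h (g i j) (fst x) * snd x $ i * cnj (snd x $ j))"
    using x fibre_derivatives(1,2)[of h _ x] base_derivatives(2)[OF x smooth_g, of h]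
    by (simp add: d_ops c wop_sum wop_mult diffS)
  have 2: "d_etabar r L x = (\<Sum>i\<in>UNIV. g i r (fst x) * snd x $ i)" for r
    using x fibre_derivatives(5,6)[of r _ x] base_derivatives(4)[OF x smooth_g, of r] exhaust_2[of r]
    by (simp add: d_ops c wop_sum wop_mult diffS) (auto simp: sum_2)
  show ?thesis
    unfolding deltabar_def 1 2 nonlin_conn_eq[OF x] lower_Gam_cnj[OF z, symmetric]
    by (simp add: sum_2 algebra_simps)
qed

text \<open>The product rule for \<open>L = F^2\<close> and \<open>F > 0\<close> reduce this to
  \<open>deltabar_L\<close>. Powers of \<open>F\<close> thus count as constants for
  \<open>deltabar\<close>.\<close>

lemma deltabar_Fc: assumes x: "x \<in> S" shows "deltabar F h Fc x = 0"
proof -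
  have "deltabar F h (\<lambda>x. Fc x * Fc x) x = deltabar F h L x"
    by (rule deltabar_cong[OF open_S x]) (simp add: L_def power2_eq_square)
  then show ?thesis
    using F_pos[OF x] by (simp add: deltabar_mult Fc_differentiable[OF x] deltabar_L[OF x])
qed

text \<open>This is \<open>F^3 J\<close>, a polynomial in the fibre coordinates and their
  conjugates.\<close>

definition Q :: "(complex^2) \<times> (complex^2) \<Rightarrow> complex" where
  "Q x = (\<Sum>j\<in>UNIV. \<Sum>k\<in>UNIV. \<Sum>m\<in>UNIV. A k j m (fst x) * (snd x $ j * snd x $ k * cnj (snd x $ m)))"

definition R3 :: "2 \<Rightarrow> (complex^2) \<times> (complex^2) \<Rightarrow> complex" where
  "R3 h x = (\<Sum>j\<in>UNIV. \<Sum>m\<in>UNIV. \<Sum>k\<in>UNIV. R j m k h (fst x) * snd x $ j * cnj (snd x $ m) * snd x $ k)"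

lemma J_inv_eq: assumes x: "x \<in> S" shows "J_inv F x * (Fc x * (Fc x * Fc x)) = Q x"
proof -
  have z: "fst x \<in> U" using x by (rule slitD)
  have "J_inv F x * (Fc x * (Fc x * Fc x)) =
    (\<Sum>j\<in>UNIV. \<Sum>k\<in>UNIV. \<Sum>m\<in>UNIV. (\<Sum>i\<in>UNIV. Gam i j k (fst x) * g i m (fst x)) * (snd x $ j * snd x $ k * cnj (snd x $ m)))"
    using F_pos[OF x]
    by (simp add: J_inv_def l_up_def l_low_def hconn_eq[OF x] gmat_eq[OF x] sum_2 field_simps)
  then show ?thesis by (simp add: lower_Gam[OF z] Q_def)
qed

lemma smooth_Q: "smooth_on Q S"
  unfolding Q_def[abs_def] by simp

text \<open>The base derivative gives the second-order term of the curvature; the fibre derivative,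
  contracted with the conjugate connection, gives the quadratic term.\<close>

lemma deltabar_Q: assumes x: "x \<in> S" shows "deltabar F h Q x = - R3 h x"
proof -
  have z: "fst x \<in> U" using x by (rule slitD)
  have 1: "d_zbar h Q x = (\<Sum>j\<in>UNIV. \<Sum>k\<in>UNIV. \<Sum>m\<in>UNIV. pzb h (A k j m) (fst x) * (snd x $ j * snd x $ k * cnj (snd x $ m)))"
    unfolding Q_def[abs_def]
    using x fibre_derivatives(1,2)[of h _ x] base_derivatives(2)[OF x smooth_A, of h]
    by (simp add: d_ops wop_sum wop_mult diffS)
  have 2: "d_etabar r Q x = (\<Sum>j\<in>UNIV. \<Sum>k\<in>UNIV. A k j r (fst x) * (snd x $ j * snd x $ k))" for r
    unfolding Q_def[abs_def]
    using x fibre_derivatives(5,6)[of r _ x] base_derivatives(4)[OF x smooth_A, of r] exhaust_2[of r]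
    by (simp add: d_ops wop_sum wop_mult diffS) (auto simp: sum_2)
  show ?thesis
    unfolding deltabar_def 1 2 nonlin_conn_eq[OF x] R3_def R_def
    by (simp add: sum_2 algebra_simps)
qed

lemma deltabar_J: assumes x: "x \<in> S" shows "deltabar F h (J_inv F) x = - R3 h x / (Fc x) ^ 3"
proof -
  \<comment> \<open>The quotient formula serves only for differentiability; the value comes from the
    product rule for \<open>F^3 J = Q\<close>.\<close>
  have "(\<lambda>y. Q y * inverse (Fc y * (Fc y * Fc y))) differentiable (at x)"
    using F_pos[OF x] by (intro differentiable_mult differentiable_inverse Fc_differentiable diffS smooth_Q x) auto
  moreover have J: "J_inv F y = Q y * inverse (Fc y * (Fc y * Fc y))" if "y \<in> S" for y
    using J_inv_eq[OF that, symmetric] F_pos[OF that] by (simp add: field_simps)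
  ultimately have dJ: "J_inv F differentiable (at x)"
    unfolding differentiable_def
    by (metis (no_types, lifting) J has_derivative_transform_within_open[OF _ open_S x])
  have "deltabar F h (\<lambda>x. J_inv F x * (Fc x * (Fc x * Fc x))) x = deltabar F h Q x"
    by (rule deltabar_cong[OF open_S x]) (rule J_inv_eq)
  then have "deltabar F h (J_inv F) x * (Fc x * (Fc x * Fc x)) = - R3 h x"
    by (simp add: deltabar_mult dJ differentiable_mult Fc_differentiable[OF x] deltabar_Fc[OF x] deltabar_Q[OF x])
  then show ?thesis using F_pos[OF x] by (simp add: field_simps power3_eq_cube)
qed

lemma K_inv_eq: assumes x: "x \<in> S"
  shows "K_inv F x * (H (fst x) (snd x))\<^sup>2 = R4 (fst x) (snd x)"
proof -
  have "H (fst x) (snd x) = Fc x * Fc x" using L_eq[OF x] by (simp add: L_def power2_eq_square)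
  moreover have "R4 (fst x) (snd x) = (\<Sum>h\<in>UNIV. cnj (snd x $ h) * R3 h x)"
    by (simp add: R4_def R3_def sum_2 algebra_simps)
  ultimately show ?thesis
    using F_pos[OF x] by (simp add: K_inv_def deltabar_J[OF x] sum_2 field_simps power3_eq_cube power2_eq_square)
qed

text \<open>Up to a nonzero factor, \<open>cnj m\<close> is the covector \<open>g(\<eta>, .)\<close>
  with its entries exchanged and one sign changed. The contraction is therefore the determinant of
  that covector and \<open>R3\<close>.\<close>

lemma J_hbar_mbar_eq_0_iff: assumes x: "x \<in> S"
  shows "J_hbar_mbar F x = 0 \<longleftrightarrow>
    R3 1 x * (\<Sum>j\<in>UNIV. g j 2 (fst x) * snd x $ j) = R3 2 x * (\<Sum>j\<in>UNIV. g j 1 (fst x) * snd x $ j)"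
proof -
  have z: "fst x \<in> U" using x by (rule slitD)
  have l: "cnj (l_low F i x) = (\<Sum>j\<in>UNIV. g j i (fst x) * snd x $ j) / Fc x" for i
    by (simp add: l_low_def gmat_eq[OF x] herm[OF z])
  define q where "q = cnj (csqrt (det (gmat F x)))"
  have "det (gmat F x) = gdet (fst x)" by (simp add: det_2 gmat_eq[OF x] gdet_def)
  then have q: "q \<noteq> 0" using gdet_nonzero[OF z] by (simp add: q_def)
  have J: "J_hbar_mbar F x = deltabar F 1 (J_inv F) x * cnj (m_up F 1 x) + deltabar F 2 (J_inv F) x * cnj (m_up F 2 x)"
    by (simp add: J_hbar_mbar_def sum_2)
  have "J_hbar_mbar F x = (R3 1 x * (\<Sum>j\<in>UNIV. g j 2 (fst x) * snd x $ j) -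
      R3 2 x * (\<Sum>j\<in>UNIV. g j 1 (fst x) * snd x $ j)) / ((Fc x) ^ 4 * q)"
    using q F_pos[OF x]
    by (simp add: J m_up_def deltabar_J[OF x] l q_def[symmetric] field_simps eval_nat_numeral)
  then show ?thesis using q F_pos[OF x] by simp
qed

lemma constant_curvature_tensor:
  assumes K: "\<And>x. x \<in> S \<Longrightarrow> K_inv F x = 2 * c" and z: "z \<in> U"
  shows "R j m k h z = c * (g j m z * g k h z + g j h z * g k m z)"
proof (rule curvature_tensor_of_quartic)
  fix v :: "complex^2" assume "v \<noteq> 0"
  then have "(z, v) \<in> S" using z by (simp add: mem_slit)
  from K_inv_eq[OF this] K[OF this]
  show "(\<Sum>j\<in>UNIV. \<Sum>m\<in>UNIV. \<Sum>k\<in>UNIV. \<Sum>h\<in>UNIV. R j m k h z * v $ j * cnj (v $ m) * v $ k * cnj (v $ h)) =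
      2 * c * (\<Sum>j\<in>UNIV. \<Sum>m\<in>UNIV. g j m z * v $ j * cnj (v $ m))\<^sup>2"
    by (simp add: R4_def H_def)
qed (use R_sym1[OF z] R_sym2[OF z] in auto)

lemma proportional_curvature_tensor:
  assumes J: "\<And>x. x \<in> S \<Longrightarrow> J_hbar_mbar F x = 0" and z: "z \<in> U"
  shows "R j m k h z = R 1 1 1 1 z / (2 * (g 1 1 z)\<^sup>2) * (g j m z * g k h z + g j h z * g k m z)"
proof (rule curvature_tensor_of_proportional)
  fix v :: "complex^2" assume "v \<noteq> 0"
  then have "(z, v) \<in> S" using z by (simp add: mem_slit)
  from J[OF this, unfolded J_hbar_mbar_eq_0_iff[OF this]]
  show "(\<Sum>j\<in>UNIV. \<Sum>m\<in>UNIV. \<Sum>k\<in>UNIV. R j m k 1 z * v $ j * cnj (v $ m) * v $ k) * (\<Sum>j\<in>UNIV. g j 2 z * v $ j) =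
      (\<Sum>j\<in>UNIV. \<Sum>m\<in>UNIV. \<Sum>k\<in>UNIV. R j m k 2 z * v $ j * cnj (v $ m) * v $ k) * (\<Sum>j\<in>UNIV. g j 1 z * v $ j)"
    by (simp add: R3_def)
qed (use R_sym1[OF z] R_sym2[OF z] g11_nonzero[OF z] gdet_nonzero[OF z] in \<open>auto simp: gdet_def\<close>)

text \<open>The way back from the tensor to both conditions: the two model terms have equal
  contractions, so \<open>R4\<close> is a multiple of \<open>H^2\<close> and \<open>R3\<close> is
  parallel to \<open>g(v, .)\<close>.\<close>

lemma curvature_tensor_imp:
  assumes R: "\<And>j m k h. R j m k h z = c * (g j m z * g k h z + g j h z * g k m z)"
    and x: "(z, v) \<in> S"
  shows "R4 z v = 2 * c * (H z v)\<^sup>2" "K_inv F (z, v) = 2 * c" "J_hbar_mbar F (z, v) = 0"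
proof -
  show R4: "R4 z v = 2 * c * (H z v)\<^sup>2"
    by (simp add: R4_def H_def R sum_2 power2_eq_square algebra_simps)
  have "H z v \<noteq> 0" using L_eq[OF x] F_pos[OF x] by (auto simp: L_def)
  then show "K_inv F (z, v) = 2 * c" using K_inv_eq[OF x] R4 by simp
  show "J_hbar_mbar F (z, v) = 0"
    unfolding J_hbar_mbar_eq_0_iff[OF x] by (simp add: R3_def R sum_2 algebra_simps)
qed

end

section \<open>The curvature factor of a chart\<close>

context finsler_chart
begin

text \<open>Solves for \<open>c\<close> in the component 1111 of the model tensor, which is
  \<open>2 c (g 1 1)^2\<close>.\<close>

definition kap :: "complex^2 \<Rightarrow> complex" where
  "kap z = R 1 1 1 1 z / (2 * (g 1 1 z)\<^sup>2)"

context
  assumes J: "\<And>x. x \<in> S \<Longrightarrow> J_hbar_mbar F x = 0"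
begin

lemma R_eq_kap: "z \<in> U \<Longrightarrow> R j m k h z = kap z * (g j m z * g k h z + g j h z * g k m z)"
  unfolding kap_def by (rule proportional_curvature_tensor[OF J])

lemma kap_derivative: "z \<in> U \<Longrightarrow> (kap has_derivative (\<lambda>v. 0)) (at z)"
  by (rule schur(1)[OF R_eq_kap])

lemma kap_real: "z \<in> U \<Longrightarrow> cnj (kap z) = kap z"
  by (rule schur(2)[OF R_eq_kap])

text \<open>The chart image may be disconnected. A ball is convex, and there a vanishing derivative
  forces constancy.\<close>

lemma kap_locally_constant:
  assumes "z \<in> U"
  obtains e where "e > 0" "ball z e \<subseteq> U" "\<And>y. y \<in> ball z e \<Longrightarrow> kap y = kap z"
proof -
  obtain e where e: "e > 0" "ball z e \<subseteq> U"
    using open_U assms open_contains_ball by blast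
  have "\<exists>c. \<forall>y\<in>ball z e. kap y = c"
    by (rule has_derivative_zero_constant)
      (use e in \<open>auto intro!: has_derivative_at_withinI[OF kap_derivative]\<close>)
  with e that show ?thesis by (metis centre_in_ball)
qed

end

lemma H_eq_F2: "(z, v) \<in> S \<Longrightarrow> H z v = of_real ((F (z, v))\<^sup>2)"
  using L_eq[of "(z, v)"] by (simp add: L_def)

end

section \<open>Coordinate changes\<close>

context complex_manifold
begin

lemma chart_openin: "c \<in> A \<Longrightarrow> openin M (fst c)"
  using charts by (auto simp: is_chart_def)

lemma chart_range_open: "c \<in> A \<Longrightarrow> open (snd c ` fst c)"
  using charts by (auto simp: is_chart_def)

lemma chart_homeomorphic:
  "c \<in> A \<Longrightarrow> homeomorphic_map (subtopology M (fst c)) (top_of_set (snd c ` fst c)) (snd c)"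
  using charts by (auto simp: is_chart_def)

lemma chart_inj: "c \<in> A \<Longrightarrow> inj_on (snd c) (fst c)"
  using homeomorphic_imp_injective_map[OF chart_homeomorphic] chart_openin[THEN openin_subset]
  by (simp add: topspace_subtopology Int_absorb1)

lemma chart_inv: "c \<in> A \<Longrightarrow> p \<in> fst c \<Longrightarrow> inv_into (fst c) (snd c) (snd c p) = p"
  by (simp add: chart_inj)

lemma chart_image_open:
  assumes "c \<in> A" "openin M V" "V \<subseteq> fst c"
  shows "open (snd c ` V)"
proof -
  have "openin (subtopology M (fst c)) V"
    using assms by (simp add: openin_subset_topspace_eq openin_open_subtopology chart_openin)
  then have "openin (top_of_set (snd c ` fst c)) (snd c ` V)"
    using homeomorphic_imp_open_map[OF chart_homeomorphic[OF assms(1)]] by (auto simp: open_map_def)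
  then show ?thesis using chart_range_open[OF assms(1)] by (simp add: openin_open_eq)
qed

lemma chart_vimage_open:
  assumes "c \<in> A" "open W"
  shows "openin M {p \<in> fst c. snd c p \<in> W}"
proof -
  have "continuous_map (subtopology M (fst c)) (top_of_set (snd c ` fst c)) (snd c)"
    by (rule homeomorphic_imp_continuous_map[OF chart_homeomorphic[OF assms(1)]])
  moreover have "openin (top_of_set (snd c ` fst c)) (snd c ` fst c \<inter> W)"
    using assms(2) by (simp add: openin_open_Int)
  ultimately have "openin (subtopology M (fst c))
      {p \<in> topspace (subtopology M (fst c)). snd c p \<in> snd c ` fst c \<inter> W}"
    by (rule openin_continuous_map_preimage)
  moreover have "{p \<in> topspace (subtopology M (fst c)). snd c p \<in> snd c ` fst c \<inter> W} = {p \<in> fst c. snd c p \<in> W}"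
    using openin_subset[OF chart_openin[OF assms(1)]] by (auto simp: topspace_subtopology)
  ultimately show ?thesis
    using openin_open_subtopology[OF chart_openin[OF assms(1)]] by auto
qed

lemma overlap_open: "c \<in> A \<Longrightarrow> d \<in> A \<Longrightarrow> open (snd c ` (fst c \<inter> fst d))"
  by (rule chart_image_open) (auto intro: chart_openin)

lemma transition_at: "c \<in> A \<Longrightarrow> p \<in> fst c \<Longrightarrow> transition c d (snd c p) = snd d p"
  by (simp add: transition_def chart_inv)

definition jac where
  "jac c d z = (SOME B :: complex^'n^'n. (transition c d has_derivative (\<lambda>v. B *v v)) (at z))"

lemma transition_derivative:
  assumes "c \<in> A" "d \<in> A" "p \<in> fst c" "p \<in> fst d"
  shows "(transition c d has_derivative (\<lambda>v. jac c d (snd c p) *v v)) (at (snd c p))"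
  unfolding jac_def
  by (rule someI_ex) (use compatible[OF assms(1,2)] assms in \<open>auto simp: holomorphic_map_on_def\<close>)

lemma transition_frechet:
  assumes "c \<in> A" "d \<in> A" "p \<in> fst c" "p \<in> fst d"
  shows "frechet_derivative (transition c d) (at (snd c p)) = (\<lambda>v. jac c d (snd c p) *v v)"
  using frechet_derivative_at[OF transition_derivative[OF assms]] by simp

text \<open>The chain rule on the triple overlap, which is open. This cocycle identity makes
  \<open>of_coords\<close> consistent across all charts.\<close>

lemma jac_chain:
  assumes "c \<in> A" "d \<in> A" "e \<in> A" "p \<in> fst c" "p \<in> fst d" "p \<in> fst e"
  shows "jac d e (snd d p) *v (jac c d (snd c p) *v v) = jac c e (snd c p) *v v"
proof -
  let ?W = "snd c ` (fst c \<inter> fst d \<inter> fst e)"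
  have "open ?W"
    using assms by (intro chart_image_open openin_Int chart_openin) auto
  have "((\<lambda>z. transition d e (transition c d z)) has_derivative
      (\<lambda>v. jac d e (snd d p) *v (jac c d (snd c p) *v v))) (at (snd c p))"
    by (rule has_derivative_compose[OF transition_derivative])
      (use assms transition_derivative[of d e p] in \<open>auto simp: transition_at\<close>)
  then have "(transition c e has_derivative
      (\<lambda>v. jac d e (snd d p) *v (jac c d (snd c p) *v v))) (at (snd c p))"
    by (rule has_derivative_transform_within_open[OF _ \<open>open ?W\<close>]) (use assms in \<open>auto simp: transition_at\<close>)
  from has_derivative_unique[OF this transition_derivative[of c e p]] assms show ?thesis
    by (simp add: fun_eq_iff)
qed

lemma jac_self:
  assumes "c \<in> A" "p \<in> fst c"
  shows "jac c c (snd c p) *v v = v"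
proof -
  have "((\<lambda>z. z) has_derivative (\<lambda>v. v)) (at (snd c p))" by (rule has_derivative_ident)
  then have "(transition c c has_derivative (\<lambda>v. v)) (at (snd c p))"
    by (rule has_derivative_transform_within_open[OF _ chart_range_open[OF assms(1)]])
      (use assms in \<open>auto simp: transition_at\<close>)
  from has_derivative_unique[OF this transition_derivative[of c c p]] assms show ?thesis
    by (metis (no_types))
qed

lemma of_coords_at:
  assumes "c \<in> A" "p \<in> fst c"
  shows "of_coords A c (snd c p, v) = (p, \<lambda>d. if d \<in> A \<and> p \<in> fst d then jac c d (snd c p) *v v else 0)"
  using assms by (auto simp: of_coords_def chart_inv transition_frechet fun_eq_iff)

lemma of_coords_tangent:
  assumes "c \<in> A" "p \<in> fst c"
  shows "of_coords A c (snd c p, v) \<in> tangent_bundle A"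
  using assms by (auto simp: of_coords_at tangent_bundle_def transition_frechet jac_chain)

lemma of_coords_scale:
  assumes "c \<in> A" "p \<in> fst c"
  shows "tangent_scale a (of_coords A c (snd c p, v)) = of_coords A c (snd c p, a *s v)"
  using assms by (auto simp: of_coords_at tangent_scale_def vector_scalar_commute fun_eq_iff)

lemma of_coords_change:
  assumes "c \<in> A" "d \<in> A" "p \<in> fst c" "p \<in> fst d"
  shows "of_coords A c (snd c p, v) = of_coords A d (snd d p, jac c d (snd c p) *v v)"
  using assms by (auto simp: of_coords_at jac_chain fun_eq_iff)

end

section \<open>Comparison of charts and gluing\<close>

lemma slit_dom_eq: "slit_dom c = slit (snd c ` fst c)"
  by (simp add: slit_dom_def slit_def)

lemma finsler_chart_local_rep:
  fixes A :: "('a, 2) chart set"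
  assumes "complex_finsler_space M A F" "kaehler A F" "purely_hermitian A F" and c: "c \<in> A"
  shows "finsler_chart (snd c ` fst c) (local_rep A F c)"
proof -
  interpret complex_finsler_space M A F by fact
  show ?thesis
  proof
    show "open (snd c ` fst c)" by (rule chart_range_open[OF c])
    show "smooth_on (\<lambda>x. (local_rep A F c x)\<^sup>2) (slit (snd c ` fst c))"
      using smooth[OF c] by (simp add: slit_dom_eq)
    show "0 \<le> local_rep A F c x" if "x \<in> slit (snd c ` fst c)" for x
      using that c by (auto simp: slit_def local_rep_def intro!: nonneg of_coords_tangent)
    show "local_rep A F c (z, a *s v) = cmod a * local_rep A F c (z, v)"
      if "(z, v) \<in> slit (snd c ` fst c)" for z v a
      using that c homogeneous[OF of_coords_tangent[OF c], of _ a v]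
      by (auto simp: slit_def local_rep_def of_coords_scale)
    show "hermitian_pos_def (gmat (local_rep A F c) x)" if "x \<in> slit (snd c ` fst c)" for x
      using pos_def[OF c] that by (simp add: slit_dom_eq)
    show "(\<Sum>j\<in>UNIV. torsion (local_rep A F c) i j k x * snd x $ j) = 0"
      if "x \<in> slit (snd c ` fst c)" for x i k
      using assms(2) c that by (simp add: kaehler_def slit_dom_eq)
    show "gmat (local_rep A F c) (z, v) = gmat (local_rep A F c) (z, v')"
      if "(z, v) \<in> slit (snd c ` fst c)" "(z, v') \<in> slit (snd c ` fst c)" for z v v'
      using assms(3) c that unfolding purely_hermitian_def slit_dom_eq by blast
  qed
qed

text \<open>For the model form \<open>R4\<close> is \<open>2 kap H^2\<close>. Here \<open>H\<close>
  is \<open>F^2\<close> of one tangent vector, hence the same positive number in both charts, and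
  dividing the curvature inequality by its square leaves the factors.\<close>

lemma kap_le:
  fixes A :: "('a, 2) chart set"
  assumes fin: "complex_finsler_space M A F" and ka: "kaehler A F" and pu: "purely_hermitian A F"
    and J: "\<And>c x. c \<in> A \<Longrightarrow> x \<in> slit_dom c \<Longrightarrow> J_hbar_mbar (local_rep A F c) x = 0"
    and c: "c \<in> A" and d: "d \<in> A" and p: "p \<in> fst c" "p \<in> fst d"
  shows "Re (finsler_chart.kap (local_rep A F c) (snd c p)) \<le> Re (finsler_chart.kap (local_rep A F d) (snd d p))"
proof -
  interpret complex_finsler_space M A F by fact
  interpret c: finsler_chart "snd c ` fst c" "local_rep A F c"
    by (rule finsler_chart_local_rep[OF fin ka pu c])
  interpret d: finsler_chart "snd d ` fst d" "local_rep A F d"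
    by (rule finsler_chart_local_rep[OF fin ka pu d])
  \<comment> \<open>Passing to \<open>d\<close> and back is the identity, so the Jacobian kills no
    nonzero vector.\<close>
  have nz: "jac c d (snd c q) *v v \<noteq> 0" if "q \<in> fst c" "q \<in> fst d" "v \<noteq> 0" for q v
    using jac_chain[OF c d c that(1,2,1), of v] jac_self[OF c that(1), of v] that(3) by auto
  have H: "c.H (snd c q) v = d.H (snd d q) (jac c d (snd c q) *v v)" if "q \<in> fst c" "q \<in> fst d" for q v
  proof (cases "v = 0")
    case True
    then show ?thesis by (simp add: c.H_def d.H_def matrix_vector_mult_0_right)
  next
    case False
    then have "(snd c q, v) \<in> c.S" "(snd d q, jac c d (snd c q) *v v) \<in> d.S"
      using nz that by (auto simp: mem_slit)
    moreover have "local_rep A F c (snd c q, v) = local_rep A F d (snd d q, jac c d (snd c q) *v v)"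
      by (simp add: local_rep_def of_coords_change[OF c d that])
    ultimately show ?thesis by (simp add: c.H_eq_F2 d.H_eq_F2)
  qed
  define v :: "complex^2" where "v = axis 1 1"
  have v: "v \<noteq> 0" by (simp add: v_def axis_eq_0_iff)
  let ?w = "jac c d (snd c p) *v v"
  have "Re (c.R4 (snd c p) v) \<le> Re (d.R4 (transition c d (snd c p)) ?w)"
    by (rule R4_le_transition[OF c.hermitian_chart_axioms d.hermitian_chart_axioms overlap_open[OF c d]])
      (use transition_derivative[OF c d] H p c in \<open>auto simp: transition_at\<close>)
  then have 1: "Re (c.R4 (snd c p) v) \<le> Re (d.R4 (snd d p) ?w)"
    using p c by (simp add: transition_at)
  have cS: "(snd c p, v) \<in> c.S" and dS: "(snd d p, ?w) \<in> d.S"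
    using nz[OF p v] p v by (auto simp: mem_slit)
  have "c.R4 (snd c p) v = 2 * c.kap (snd c p) * (c.H (snd c p) v)\<^sup>2"
    by (rule c.curvature_tensor_imp(1)[OF c.R_eq_kap cS]) (use J c p in \<open>auto simp: slit_dom_eq\<close>)
  moreover have "d.R4 (snd d p) ?w = 2 * d.kap (snd d p) * (d.H (snd d p) ?w)\<^sup>2"
    by (rule d.curvature_tensor_imp(1)[OF d.R_eq_kap dS]) (use J d p in \<open>auto simp: slit_dom_eq\<close>)
  moreover define r where "r = (local_rep A F c (snd c p, v))\<^sup>2"
  have "c.H (snd c p) v = of_real r" "d.H (snd d p) ?w = of_real r"
    using c.H_eq_F2[OF cS] H[OF p, of v] by (simp_all add: r_def)
  moreover have "r > 0" using c.F_pos[OF cS] by (simp add: r_def)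
  ultimately show ?thesis using 1 by (simp flip: of_real_power)
qed

theorem theorem4p10:
  fixes M :: "'a topology" and A :: "('a, 2) chart set" and F :: "('a, 2) tangent \<Rightarrow> real"
  assumes "complex_finsler_space M A F"
    and "connected_space M"
    and "kaehler A F"
    and "purely_hermitian A F"
  shows "(\<exists>\<kappa>. \<forall>c\<in>A. \<forall>x\<in>slit_dom c. K_inv (local_rep A F c) x = \<kappa>) \<longleftrightarrow>
         (\<forall>c\<in>A. \<forall>x\<in>slit_dom c. J_hbar_mbar (local_rep A F c) x = 0)"
proof
  assume "\<exists>\<kappa>. \<forall>c\<in>A. \<forall>x\<in>slit_dom c. K_inv (local_rep A F c) x = \<kappa>"
  then obtain \<kappa> where \<kappa>: "\<And>c x. c \<in> A \<Longrightarrow> x \<in> slit_dom c \<Longrightarrow> K_inv (local_rep A F c) x = \<kappa>" by blast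
  show "\<forall>c\<in>A. \<forall>x\<in>slit_dom c. J_hbar_mbar (local_rep A F c) x = 0"
  proof (intro ballI)
    fix c x assume c: "c \<in> A" and x: "x \<in> slit_dom c"
    interpret finsler_chart "snd c ` fst c" "local_rep A F c"
      by (rule finsler_chart_local_rep[OF assms(1,3,4) c])
    obtain z v where x_eq: "x = (z, v)" by fastforce
    have zv: "(z, v) \<in> S" using x by (simp add: x_eq slit_dom_eq)
    \<comment> \<open>Half of \<open>\<kappa>\<close>, because the model tensor with factor
      \<open>c\<close> has \<open>K = 2 c\<close>.\<close>
    have "R j m k h z = \<kappa> / 2 * (g j m z * g k h z + g j h z * g k m z)" for j m k h
      by (rule constant_curvature_tensor) (use \<kappa>[OF c] zv in \<open>auto simp: slit_dom_eq mem_slit\<close>)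
    from curvature_tensor_imp(3)[OF this zv] show "J_hbar_mbar (local_rep A F c) x = 0"
      by (simp add: x_eq)
  qed
next
  assume J0: "\<forall>c\<in>A. \<forall>x\<in>slit_dom c. J_hbar_mbar (local_rep A F c) x = 0"
  interpret complex_finsler_space M A F by fact
  note fc = finsler_chart_local_rep[OF assms(1,3,4)]
  define k where "k c = finsler_chart.kap (local_rep A F c)" for c
  have J: "J_hbar_mbar (local_rep A F c) x = 0" if "c \<in> A" "x \<in> slit (snd c ` fst c)" for c x
    using J0 that by (simp add: slit_dom_eq)
  have K: "K_inv (local_rep A F c) x = 2 * k c (fst x)" if c: "c \<in> A" and x: "x \<in> slit_dom c" for c x
  proof -
    interpret finsler_chart "snd c ` fst c" "local_rep A F c" by (rule fc[OF c])
    obtain z v where x_eq: "x = (z, v)" by fastforce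
    have zv: "(z, v) \<in> S" using x by (simp add: x_eq slit_dom_eq)
    have "R j m k h z = kap z * (g j m z * g k h z + g j h z * g k m z)" for j m k h
      by (rule R_eq_kap[OF J[OF c]]) (use zv in \<open>auto simp: mem_slit\<close>)
    from curvature_tensor_imp(2)[OF this zv] show ?thesis by (simp add: x_eq k_def)
  qed
  \<comment> \<open>\<open>kap_le\<close> in both orders of the charts settles the real parts,
    reality of the factors the imaginary ones.\<close>
  have agree: "k c (snd c p) = k d (snd d p)" if "c \<in> A" "d \<in> A" "p \<in> fst c" "p \<in> fst d" for c d p
  proof (rule complex_eqI)
    have "Re (k c (snd c p)) \<le> Re (k d (snd d p))" if "c \<in> A" "d \<in> A" "p \<in> fst c" "p \<in> fst d" for c d
      unfolding k_def by (rule kap_le[OF assms(1,3,4)]) (use J0 that in auto)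
    then show "Re (k c (snd c p)) = Re (k d (snd d p))" using that by (meson antisym)
    have "Im (k c (snd c p)) = 0" if "c \<in> A" "p \<in> fst c" for c
    proof -
      have "cnj (k c (snd c p)) = k c (snd c p)"
        unfolding k_def by (rule finsler_chart.kap_real[OF fc[OF that(1)] J[OF that(1)]]) (use that in auto)
      then show ?thesis by (simp add: complex_eq_iff)
    qed
    then show "Im (k c (snd c p)) = Im (k d (snd d p))" using that by simp
  qed
  \<comment> \<open>A general \<open>P\<close> covers both the set where the factor takes a given
    value and the set where it takes another one; local constancy makes each open.\<close>
  have op: "openin M {p. \<exists>c\<in>A. p \<in> fst c \<and> P (k c (snd c p))}" for P
  proof (subst openin_subopen, clarify)
    fix p a b assume c: "(a, b) \<in> A" and p: "p \<in> fst (a, b)" and P: "P (k (a, b) (snd (a, b) p))"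
    \<comment> \<open>The pair into which \<open>clarify\<close> has split the chart is put together
      again.\<close>
    define c where "c = (a, b)"
    obtain e where e: "e > 0" "\<And>y. y \<in> ball (snd c p) e \<Longrightarrow> k c y = k c (snd c p)"
      using finsler_chart.kap_locally_constant[OF fc J, of c "snd c p"] c p unfolding k_def c_def by (metis imageI)
    have "openin M {q \<in> fst c. snd c q \<in> ball (snd c p) e}"
      by (rule chart_vimage_open) (use c in \<open>auto simp: c_def\<close>)
    moreover have "p \<in> {q \<in> fst c. snd c q \<in> ball (snd c p) e}" using p e(1) by (simp add: c_def)
    moreover have "{q \<in> fst c. snd c q \<in> ball (snd c p) e} \<subseteq> {p. \<exists>c\<in>A. p \<in> fst c \<and> P (k c (snd c p))}"
    proof clarify
      fix q assume "q \<in> fst c" "snd c q \<in> ball (snd c p) e"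
      then show "\<exists>c\<in>A. q \<in> fst c \<and> P (k c (snd c q))"
        using c P e(2)[of "snd c q"] by (intro bexI[of _ c]) (auto simp: c_def)
    qed
    ultimately show "\<exists>T. openin M T \<and> p \<in> T \<and> T \<subseteq> {p. \<exists>c\<in>A. p \<in> fst c \<and> P (k c (snd c p))}" by blast
  qed
  show "\<exists>\<kappa>. \<forall>c\<in>A. \<forall>x\<in>slit_dom c. K_inv (local_rep A F c) x = \<kappa>"
  \<comment> \<open>Over the empty space any constant will do; otherwise the value at one point is
    the candidate.\<close>
  proof (cases "topspace M = {}")
    case True
    then have "slit_dom c = {}" if "c \<in> A" for c using cover that by (auto simp: slit_dom_def)
    then show ?thesis by auto
  next
    case False
    then obtain p0 c0 where c0: "c0 \<in> A" "p0 \<in> fst c0" using cover by auto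
    define k0 where "k0 = k c0 (snd c0 p0)"
    let ?E = "\<lambda>P. {p. \<exists>c\<in>A. p \<in> fst c \<and> P (k c (snd c p))}"
    have "topspace M \<subseteq> ?E (\<lambda>y. y = k0) \<union> ?E (\<lambda>y. y \<noteq> k0)" using cover by auto
    \<comment> \<open>The sets are disjoint because all charts around a point give the same factor
      there.\<close>
    moreover have "?E (\<lambda>y. y = k0) \<inter> ?E (\<lambda>y. y \<noteq> k0) = {}"
    proof (rule ccontr)
      assume "?E (\<lambda>y. y = k0) \<inter> ?E (\<lambda>y. y \<noteq> k0) \<noteq> {}"
      then obtain p c d where "c \<in> A" "d \<in> A" "p \<in> fst c" "p \<in> fst d" "k c (snd c p) = k0" "k d (snd d p) \<noteq> k0"
        by blast
      then show False using agree[of c d p] by simp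
    qed
    moreover have "p0 \<in> ?E (\<lambda>y. y = k0)" using c0 by (auto simp: k0_def)
    ultimately have "?E (\<lambda>y. y \<noteq> k0) = {}"
      using assms(2) op[of "\<lambda>y. y = k0"] op[of "\<lambda>y. y \<noteq> k0"] unfolding connected_space_def by blast
    then have "k c (snd c p) = k0" if "c \<in> A" "p \<in> fst c" for c p using that by blast
    then have "K_inv (local_rep A F c) x = 2 * k0" if "c \<in> A" "x \<in> slit_dom c" for c x
    proof -
      have "fst x \<in> snd c ` fst c" using \<open>x \<in> slit_dom c\<close> by (simp add: slit_dom_def mem_Times_iff)
      then obtain q where "q \<in> fst c" "fst x = snd c q" by blast
      with K[OF that] \<open>c \<in> A\<close> show ?thesis
        using \<open>\<And>p c. c \<in> A \<Longrightarrow> p \<in> fst c \<Longrightarrow> k c (snd c p) = k0\<close> by simp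
    qed
    then show ?thesis by blast
  qed
qed

end
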